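(* Let $A_1$ and $A_2$ be unital $C^*$-algebras and let $\phi\colon A_{1+}^{-1}\to A_{2+}^{-1}$ be a surjection. Then the following are equivalent: (i) $\|\phi(x)\phi(y)^{-1}\|=\|xy^{-1}\|$ for all $x,y\in A_{1+}^{-1}$; (ii) there exists a Jordan $*$-isomorphism $J\colon A_1\to A_2$ such that $\phi(x)=(\phi(e)J(x)^2\phi(e))^{1/2}$ for all $x\in A_{1+}^{-1}$. Moreover, when $\phi$ satisfies (i), or equivalently (ii), the map $\phi$ is additive (that is, $\phi(x+y)=\phi(x)+\phi(y)$ for all $x,y\in A_{1+}^{-1}$) if and only if $\phi(e)$ is a central element of $A_2$; in this case, with $J$ as in (ii), $\phi(x)=\phi(e)J(x)$ for all $x\in A_{1+}^{-1}$.
   Context: For a unital $C^*$-algebra $A$ (unit always denoted $e$), $A_+^{-1}$ denotes the positive definite cone of $A$, i.e. the set of all positive invertible elements of $A$; $A_{j+}^{-1}$ denotes this cone for $A=A_j$. Square roots of positive elements are the positive square roots. A Jordan $*$-isomorphism $J\colon A_1\to A_2$ is a complex linear bijection that preserves the Jordan product $(ab+ba)/2$ and the involution. *)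

theory Defs
  imports Complex_Main
begin

text \<open>
  Unital \<open>C\<^sup>*\<close>-algebras. The underlying class supplies the complete submultiplicative norm, the unit
  and its normalisation \<open>norm 1 = 1\<close> (hence \<open>0 \<noteq> 1\<close>); the complex scalar multiplication is required
  to extend the real one.
\<close>

class cstar_algebra = real_normed_algebra_1 + banach +
  fixes scaleC :: "complex \<Rightarrow> 'a \<Rightarrow> 'a" (infixr \<open>*\<^sub>C\<close> 75)
    and cstar_adj :: "'a \<Rightarrow> 'a"
  assumes scaleC_add_right: "c *\<^sub>C (x + y) = c *\<^sub>C x + c *\<^sub>C y"
    and scaleC_add_left: "(c + d) *\<^sub>C x = c *\<^sub>C x + d *\<^sub>C x"
    and scaleC_scaleC: "c *\<^sub>C d *\<^sub>C x = (c * d) *\<^sub>C x"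
    and scaleC_of_real: "complex_of_real r *\<^sub>C x = r *\<^sub>R x"
    and mult_scaleC_left: "(c *\<^sub>C x) * y = c *\<^sub>C (x * y)"
    and mult_scaleC_right: "x * (c *\<^sub>C y) = c *\<^sub>C (x * y)"
    and norm_scaleC: "norm (c *\<^sub>C x) = cmod c * norm x"
    and cstar_adj_add: "cstar_adj (x + y) = cstar_adj x + cstar_adj y"
    and cstar_adj_scaleC: "cstar_adj (c *\<^sub>C x) = cnj c *\<^sub>C cstar_adj x"
    and cstar_adj_mult: "cstar_adj (x * y) = cstar_adj y * cstar_adj x"
    and cstar_adj_adj: "cstar_adj (cstar_adj x) = x"
    and cstar_identity: "norm (cstar_adj x * x) = (norm x)\<^sup>2"

definition alg_invertible :: "'a::ring_1 \<Rightarrow> bool" where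
  "alg_invertible a \<longleftrightarrow> (\<exists>b. a * b = 1 \<and> b * a = 1)"

text \<open>The two-sided inverse; meaningful only for invertible elements.\<close>

definition alg_inv :: "'a::ring_1 \<Rightarrow> 'a" where
  "alg_inv a = (THE b. a * b = 1 \<and> b * a = 1)"

definition cstar_spectrum :: "'a::cstar_algebra \<Rightarrow> complex set" where
  "cstar_spectrum a = {c. \<not> alg_invertible (a - c *\<^sub>C 1)}"

definition cstar_positive :: "'a::cstar_algebra \<Rightarrow> bool" where
  "cstar_positive a \<longleftrightarrow>
     cstar_adj a = a \<and> cstar_spectrum a \<subseteq> {complex_of_real r |r. 0 \<le> r}"

definition pos_def_cone :: "'a::cstar_algebra set" where
  "pos_def_cone = {a. cstar_positive a \<and> alg_invertible a}"

text \<open>The positive square root; meaningful only for positive elements.\<close>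

definition pos_sqrt :: "'a::cstar_algebra \<Rightarrow> 'a" where
  "pos_sqrt a = (THE b. cstar_positive b \<and> b\<^sup>2 = a)"

definition jordan_prod :: "'a::cstar_algebra \<Rightarrow> 'a \<Rightarrow> 'a" where
  "jordan_prod a b = (1 / 2) *\<^sub>R (a * b + b * a)"

definition jordan_star_iso :: "('a::cstar_algebra \<Rightarrow> 'b::cstar_algebra) \<Rightarrow> bool" where
  "jordan_star_iso J \<longleftrightarrow>
     bij J \<and>
     (\<forall>a b. J (a + b) = J a + J b) \<and>
     (\<forall>c a. J (c *\<^sub>C a) = c *\<^sub>C J a) \<and>
     (\<forall>a b. J (jordan_prod a b) = jordan_prod (J a) (J b)) \<and>
     (\<forall>a. J (cstar_adj a) = cstar_adj (J a))"

definition central :: "'a::cstar_algebra \<Rightarrow> bool" where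
  "central z \<longleftrightarrow> (\<forall>a. z * a = a * z)"

end

theory Submission
  imports Defs "HOL-Analysis.Analysis"
begin

text \<open>
  By the \<open>C\<^sup>*\<close>-identity, \<open>norm (x y\<^sup>-\<^sup>1) \<le> c\<close> means \<open>x\<^sup>2 \<sqsubseteq> c\<^sup>2 y\<^sup>2\<close>. Hence condition (i) says that
  \<open>\<psi> x = (\<phi> (x\<^sup>1\<^sup>/\<^sup>2))\<^sup>2\<close> preserves and reflects all relations \<open>x \<sqsubseteq> r y\<close> on the cone. Since these gauges
  determine the order among sums, such a \<open>\<psi>\<close> is additive (after Noll and Schaeffer), so it extends
  to a linear order isomorphism. Normalised by \<open>\<phi> 1\<close> this isomorphism is unital, and Kadison's
  inequality for it and for its inverse makes it a Jordan isomorphism. If \<open>\<phi>\<close> is additive, comparing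
  \<open>(\<phi> (x + 1))\<^sup>2\<close> with \<open>(\<phi> x)\<^sup>2\<close> yields \<open>\<phi> x \<phi> 1 + \<phi> 1 \<phi> x = 2 \<phi> 1 J x \<phi> 1\<close>, so \<open>J x\<close> is at once the
  real part and the absolute value of \<open>\<phi> x (\<phi> 1)\<^sup>-\<^sup>1\<close>, which forces \<open>J x\<close> to commute with \<open>\<phi> 1\<close>.
\<close>

text \<open>Everything is run from the order. Positivity is handled as invertibility of
  \<open>a + of_real r\<close> for all \<open>r > 0\<close>, and one fact of spectral theory, that
  \<open>norm a\<close> or \<open>- norm a\<close> lies in the spectrum of a self-adjoint
  \<open>a\<close>, makes norm and order determine each other. Sums, conjugates and square roots of
  positive elements are then reached by algebra and a contraction argument, with neither functional
  calculus nor states. The main obstacle is that gauges compare elements two at a time, while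
  additivity concerns three. It is overcome by testing: \<open>c \<sqsubseteq> a + b\<close> follows
  once every \<open>y\<close> in the cone with \<open>a \<sqsubseteq> s *\<^sub>R y\<close> and
  \<open>b \<sqsubseteq> t *\<^sub>R y\<close> satisfies
  \<open>c \<sqsubseteq> (s + t) *\<^sub>R y\<close>. The test involves pairs only, so it can be
  carried across \<open>\<psi>\<close> in both directions; surjectivity supplies the test elements.
  The norm of \<open>x * alg_inv y\<close> sees \<open>x\<close> and \<open>y\<close> only through
  their squares. This is why \<open>\<psi>\<close>, and not \<open>\<phi>\<close>, turns out to be
  linear, and why additivity of \<open>\<phi>\<close> itself is a genuine restriction.\<close>

abbreviation self_adjoint :: "'a::cstar_algebra \<Rightarrow> bool" where
  "self_adjoint a \<equiv> cstar_adj a = a"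

abbreviation cstar_le :: "'a::cstar_algebra \<Rightarrow> 'a \<Rightarrow> bool" (infix "\<sqsubseteq>" 50) where
  "a \<sqsubseteq> b \<equiv> cstar_positive (b - a)"

section \<open>Inverses in unital rings and Banach algebras\<close>

lemma alg_invI:
  assumes "a * b = 1" "b * a = 1"
  shows "alg_invertible a" "alg_inv a = b"
proof -
  show "alg_invertible a" using assms unfolding alg_invertible_def by blast
  show "alg_inv a = b" unfolding alg_inv_def
  proof (rule the_equality)
    fix c assume "a * c = 1 \<and> c * a = 1"
    then show "c = b" using assms by (metis mult.assoc mult_1_left mult_1_right)
  qed (use assms in auto)
qed

lemma alg_inv_cancel [simp]:
  assumes "alg_invertible a"
  shows "a * alg_inv a = 1" "alg_inv a * a = 1"
  using assms alg_invI(2) unfolding alg_invertible_def by metis+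

lemma alg_inv_cancel_assoc [simp]:
  assumes "alg_invertible a"
  shows "a * (alg_inv a * x) = x" "alg_inv a * (a * x) = x"
  by (simp_all add: assms flip: mult.assoc)

lemma alg_inv_cancel_right [simp]:
  assumes "alg_invertible a"
  shows "x * a * alg_inv a = x" "x * alg_inv a * a = x"
  by (simp_all add: assms mult.assoc)

lemma alg_inv_invertible [simp]: "alg_invertible a \<Longrightarrow> alg_invertible (alg_inv a)"
  using alg_invI(1) alg_inv_cancel by blast

lemma alg_invertible_1 [simp]: "alg_invertible 1" and alg_inv_1 [simp]: "alg_inv 1 = 1"
  using alg_invI[of 1 1] by auto

lemma alg_invertible_mult:
  assumes "alg_invertible a" "alg_invertible b"
  shows "alg_invertible (a * b)"
proof (rule alg_invI)
  show "a * b * (alg_inv b * alg_inv a) = 1" "alg_inv b * alg_inv a * (a * b) = 1"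
    using assms by (simp_all add: mult.assoc)
qed

lemma alg_invertible_mult_iff:
  assumes "alg_invertible a"
  shows "alg_invertible (a * b) \<longleftrightarrow> alg_invertible b" "alg_invertible (b * a) \<longleftrightarrow> alg_invertible b"
proof -
  have "alg_inv a * (a * b) = b" "b * a * alg_inv a = b" using assms by simp_all
  then show "alg_invertible (a * b) \<longleftrightarrow> alg_invertible b" "alg_invertible (b * a) \<longleftrightarrow> alg_invertible b"
    using alg_invertible_mult assms alg_inv_invertible by metis+
qed

lemma alg_invertible_scaleR:
  fixes a :: "'a::real_algebra_1"
  assumes "r \<noteq> 0"
  shows "alg_invertible (r *\<^sub>R a) \<longleftrightarrow> alg_invertible a"
proof -
  have *: "alg_invertible (s *\<^sub>R b)" if "s \<noteq> 0" "alg_invertible b" for s and b :: 'a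
    using that by (intro alg_invI[of _ "inverse s *\<^sub>R alg_inv b"]) auto
  show ?thesis using *[of r a] *[of "inverse r" "r *\<^sub>R a"] assms by auto
qed

lemma alg_invertible_minus:
  fixes a :: "'a::real_algebra_1"
  shows "alg_invertible (- a) \<longleftrightarrow> alg_invertible a"
  using alg_invertible_scaleR[of "-1" a] by simp

text \<open>Apart from 0, the products \<open>a * b\<close> and \<open>b * a\<close> have the same
  spectrum: with \<open>c\<close> the inverse of \<open>b * a + r\<close>, the other inverse is
  \<open>(1 - a * c * b) / r\<close>. It serves to move a factor around in
  \<open>x * p * x\<close>.\<close>

lemma alg_invertible_add_swap:
  fixes a b :: "'a::real_algebra_1"
  assumes "alg_invertible (b * a + of_real r)" "r \<noteq> 0"
  shows "alg_invertible (a * b + of_real r)"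
proof -
  let ?c = "alg_inv (b * a + of_real r)"
  have 1: "b * a * ?c = 1 - r *\<^sub>R ?c"
    using alg_inv_cancel(1)[OF assms(1)] by (simp add: algebra_simps scaleR_conv_of_real)
  have 2: "?c * (b * a) = 1 - r *\<^sub>R ?c"
    using alg_inv_cancel(2)[OF assms(1)] by (simp add: algebra_simps of_real_def)
  have "(a * b + of_real r) * (inverse r *\<^sub>R (1 - a * ?c * b))
      = inverse r *\<^sub>R (a * b + of_real r - a * (b * a * ?c) * b - r *\<^sub>R (a * ?c * b))"
    by (simp add: algebra_simps of_real_def)
  also have "\<dots> = 1" unfolding 1 using assms(2) by (simp add: algebra_simps of_real_def)
  finally have L: "(a * b + of_real r) * (inverse r *\<^sub>R (1 - a * ?c * b)) = 1" .
  have "(inverse r *\<^sub>R (1 - a * ?c * b)) * (a * b + of_real r)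
      = inverse r *\<^sub>R (a * b + of_real r - a * (?c * (b * a)) * b - r *\<^sub>R (a * ?c * b))"
    by (simp add: algebra_simps of_real_def)
  also have "\<dots> = 1" unfolding 2 using assms(2) by (simp add: algebra_simps of_real_def)
  finally show ?thesis using L alg_invI(1) by blast
qed

lemma neumann:
  fixes x :: "'a::{real_normed_algebra_1,banach}"
  assumes "norm x < 1"
  shows "alg_invertible (1 - x)"
proof -
  have s: "summable (\<lambda>n. x ^ n)" using complete_algebra_summable_geometric[OF assms] .
  let ?S = "\<Sum>n. x ^ n"
  have "(\<Sum>n. x ^ Suc n) = ?S - 1"
    using suminf_split_head[OF s] by simp
  moreover have "(\<Sum>n. x ^ Suc n) = x * ?S" using suminf_mult[OF s, of x] by simp
  moreover have "(\<Sum>n. x ^ Suc n) = ?S * x" using suminf_mult2[OF s, of x] by (simp add: power_commutes)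
  ultimately show ?thesis by (intro alg_invI(1)[of _ ?S]) (auto simp: algebra_simps)
qed

text \<open>Neumann series for \<open>w * (1 - alg_inv w * h)\<close>. The threshold 1/2 bounds the
  new inverse by twice the norm of the old one, which yields an explicit local Lipschitz constant
  for inversion.\<close>

lemma alg_invertible_perturb:
  fixes w :: "'a::{real_normed_algebra_1,banach}"
  assumes "alg_invertible w" "norm h * norm (alg_inv w) \<le> 1 / 2"
  shows "alg_invertible (w - h)"
    and "norm (alg_inv (w - h) - alg_inv w) \<le> 2 * (norm (alg_inv w))\<^sup>2 * norm h"
proof -
  let ?R = "alg_inv w" let ?S = "alg_inv (w - h)"
  have "norm (?R * h) < 1" using assms(2) norm_mult_ineq[of ?R h] by (simp add: mult.commute)
  then have "alg_invertible (w * (1 - ?R * h))" using neumann assms(1) alg_invertible_mult by blast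
  then show i: "alg_invertible (w - h)" using assms(1) by (simp add: algebra_simps)
  have "?R * ((w - h) + h) * ?S = ?S" using assms(1) by simp
  then have "?S = ?R * ((w - h) * ?S) + ?R * h * ?S"
    by (simp only: distrib_left distrib_right mult.assoc)
  then have *: "?S = ?R + ?R * h * ?S" using i by simp
  have le: "norm (?R * h * ?S) \<le> norm ?R * norm h * norm ?S"
    by (meson mult_right_mono norm_ge_zero norm_mult_ineq order_trans)
  have "norm ?S \<le> norm ?R + norm (?R * h * ?S)" using norm_triangle_ineq * by metis
  also have "\<dots> \<le> norm ?R + 1/2 * norm ?S"
    using le mult_right_mono[OF assms(2), of "norm ?S"] by (simp add: mult.commute)
  finally have S: "norm ?S \<le> 2 * norm ?R" by simp
  have "norm (?S - ?R) = norm (?R * h * ?S)" using * by (metis add_diff_cancel_left')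
  also have "\<dots> \<le> norm ?R * norm h * (2 * norm ?R)"
    using le S by (meson mult_left_mono mult_nonneg_nonneg norm_ge_zero order_trans)
  finally show "norm (?S - ?R) \<le> 2 * (norm ?R)\<^sup>2 * norm h" by (simp add: power2_eq_square mult.commute mult.left_commute)
qed

section \<open>Complex scalars and the involution\<close>

lemma scaleC_minus_left: "(- c) *\<^sub>C x = - (c *\<^sub>C (x::'a::cstar_algebra))"
proof -
  have "(- c) *\<^sub>C x + c *\<^sub>C x = (0::complex) *\<^sub>C x" by (simp flip: scaleC_add_left)
  also have "\<dots> = 0" using scaleC_of_real[of 0 x] by simp
  finally show ?thesis by (simp add: eq_neg_iff_add_eq_0)
qed

lemma scaleC_minus_right: "c *\<^sub>C (- x) = - (c *\<^sub>C (x::'a::cstar_algebra))"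
  using scaleC_scaleC[of c "-1" x] scaleC_scaleC[of "-1" c x] scaleC_of_real[of "-1" x]
    scaleC_of_real[of "-1" "c *\<^sub>C x"] by (simp add: mult.commute)

lemma scaleC_diff_right: "c *\<^sub>C (x - y) = c *\<^sub>C x - c *\<^sub>C (y::'a::cstar_algebra)"
  using scaleC_add_right[of c x "- y"] by (simp add: scaleC_minus_right)

lemma scaleC_diff_left: "(c - d) *\<^sub>C x = c *\<^sub>C x - d *\<^sub>C (x::'a::cstar_algebra)"
  using scaleC_add_left[of c "- d" x] by (simp add: scaleC_minus_left)

lemma scaleC_one [simp]: "1 *\<^sub>C x = (x::'a::cstar_algebra)"
  using scaleC_of_real[of 1 x] by simp

lemma scaleC_of_real_one: "complex_of_real r *\<^sub>C 1 = (of_real r :: 'a::cstar_algebra)"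
  unfolding scaleC_of_real by (simp add: of_real_def)

lemma scaleC_scaleR: "c *\<^sub>C r *\<^sub>R x = r *\<^sub>R c *\<^sub>C (x::'a::cstar_algebra)"
  by (metis scaleC_scaleC scaleC_of_real mult.commute)

lemma cstar_adj_scaleR [simp]: "cstar_adj (r *\<^sub>R x) = r *\<^sub>R cstar_adj (x::'a::cstar_algebra)"
  using cstar_adj_scaleC[of "complex_of_real r" x] by (simp add: scaleC_of_real)

lemma cstar_adj_zero [simp]: "cstar_adj 0 = (0::'a::cstar_algebra)"
  using cstar_adj_scaleR[of 0 0] by simp

lemma cstar_adj_minus [simp]: "cstar_adj (- x) = - cstar_adj (x::'a::cstar_algebra)"
  using cstar_adj_scaleR[of "-1" x] by simp

lemma cstar_adj_diff [simp]: "cstar_adj (x - y) = cstar_adj x - cstar_adj (y::'a::cstar_algebra)"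
  using cstar_adj_add[of x "- y"] by simp

lemma cstar_adj_one [simp]: "cstar_adj 1 = (1::'a::cstar_algebra)"
  by (metis cstar_adj_adj cstar_adj_mult mult_1_left mult_1_right)

lemma cstar_adj_of_real [simp]: "cstar_adj (of_real r) = (of_real r::'a::cstar_algebra)"
  by (simp add: of_real_def)

lemma cstar_adj_power [simp]: "cstar_adj (x ^ n) = cstar_adj (x::'a::cstar_algebra) ^ n"
  by (induction n) (simp_all add: cstar_adj_mult power_commutes)

declare cstar_adj_add [simp] cstar_adj_adj [simp]

lemma alg_inv_adj:
  fixes a :: "'a::cstar_algebra"
  assumes "alg_invertible a"
  shows "alg_invertible (cstar_adj a)" "alg_inv (cstar_adj a) = cstar_adj (alg_inv a)"
  using alg_invI[of "cstar_adj a" "cstar_adj (alg_inv a)"] assms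
  by (simp_all flip: cstar_adj_mult)

lemma norm_cstar_adj [simp]: "norm (cstar_adj x) = norm (x::'a::cstar_algebra)"
proof -
  have *: "norm y \<le> norm (cstar_adj y)" for y :: 'a
  proof (cases "y = 0")
    case False
    have "norm y * norm y \<le> norm (cstar_adj y) * norm y"
      using cstar_identity[of y] norm_mult_ineq[of "cstar_adj y" y] by (simp add: power2_eq_square)
    then show ?thesis using False by simp
  qed simp
  show ?thesis using *[of x] *[of "cstar_adj x"] by simp
qed

lemma continuous_on_cstar_adj [continuous_intros]:
  "continuous_on S (cstar_adj :: 'a::cstar_algebra \<Rightarrow> 'a)"
  by (rule continuous_onI) (metis cstar_adj_diff dist_norm norm_cstar_adj order_less_imp_le)

lemma norm_self_adjoint_square:
  "self_adjoint (a::'a::cstar_algebra) \<Longrightarrow> norm (a * a) = (norm a)\<^sup>2"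
  using cstar_identity[of a] by simp

lemma norm_self_adjoint_power2:
  assumes "self_adjoint (a::'a::cstar_algebra)"
  shows "norm (a ^ (2 ^ k)) = norm a ^ (2 ^ k)"
proof (induction k)
  case (Suc k)
  have "a ^ (2 ^ Suc k) = a ^ (2^k) * a ^ (2^k)" by (simp add: mult_2 power_add)
  then show ?case using Suc norm_self_adjoint_square[of "a ^ (2^k)"] assms
    by (simp add: mult_2 power_add power2_eq_square)
qed simp

section \<open>The spectrum of a self-adjoint element\<close>

text \<open>By the C*-identity, since \<open>(a - il)(a + il) = a^2 + l^2\<close>. The point is that
  no term linear in \<open>l\<close> appears.\<close>

lemma norm_add_imaginary:
  assumes "self_adjoint (a::'a::cstar_algebra)"
  shows "(norm (a + (\<i> * complex_of_real l) *\<^sub>C 1))\<^sup>2 \<le> (norm a)\<^sup>2 + l\<^sup>2"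
proof -
  let ?x = "a + (\<i> * complex_of_real l) *\<^sub>C 1"
  have "cstar_adj ?x * ?x = (a - (\<i> * complex_of_real l) *\<^sub>C 1) * ?x"
    using assms by (simp add: cstar_adj_scaleC scaleC_minus_left)
  also have "\<dots> = a * a - ((\<i> * complex_of_real l) * (\<i> * complex_of_real l)) *\<^sub>C 1"
    by (simp add: algebra_simps mult_scaleC_left mult_scaleC_right scaleC_scaleC scaleC_diff_right)
  also have "(\<i> * complex_of_real l) * (\<i> * complex_of_real l) = - complex_of_real (l\<^sup>2)"
    by (simp add: complex_eq_iff power2_eq_square)
  finally have "cstar_adj ?x * ?x = a * a + of_real (l\<^sup>2)"
    by (simp only: scaleC_minus_left scaleC_of_real_one diff_minus_eq_add)
  then have "(norm ?x)\<^sup>2 = norm (a * a + of_real (l\<^sup>2))" using cstar_identity[of ?x] by simp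
  also have "\<dots> \<le> norm (a * a) + norm (of_real (l\<^sup>2) :: 'a)" by (rule norm_triangle_ineq)
  finally show ?thesis using assms norm_of_real[of "l\<^sup>2", where ?'a = 'a]
    by (simp add: norm_self_adjoint_square del: of_real_power)
qed

lemma alg_invertible_scaleC_minus:
  fixes a :: "'a::cstar_algebra"
  assumes "norm a < cmod c"
  shows "alg_invertible (a - c *\<^sub>C 1)"
proof -
  have c: "c \<noteq> 0" using assms by auto
  have "norm (inverse c *\<^sub>C a) < 1"
    using assms c by (simp add: norm_scaleC norm_inverse) (simp add: field_simps norm_divide)
  then have 1: "alg_invertible (1 - inverse c *\<^sub>C a)" by (rule neumann)
  have "alg_invertible ((-c) *\<^sub>C (1::'a))"
    using c by (intro alg_invI[of _ "(- inverse c) *\<^sub>C 1"])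
      (auto simp: mult_scaleC_left scaleC_scaleC)
  then have "alg_invertible ((-c) *\<^sub>C 1 * (1 - inverse c *\<^sub>C a))" using 1 alg_invertible_mult by blast
  then show ?thesis using c by (simp add: mult_scaleC_left scaleC_diff_right scaleC_scaleC scaleC_minus_left)
qed

text \<open>Shift by \<open>il\<close>: the square of the norm of \<open>a + il\<close> is at most
  \<open>norm a ^ 2 + l ^ 2\<close>, whereas that of \<open>cmod (c + il)\<close> contains the extra
  term \<open>2 l Im c\<close>. For suitable \<open>l\<close> the shifted number exceeds the norm,
  so it is not in the spectrum.\<close>

lemma self_adjoint_spectrum_real:
  fixes a :: "'a::cstar_algebra"
  assumes sa: "self_adjoint a" and im: "Im c \<noteq> 0"
  shows "alg_invertible (a - c *\<^sub>C 1)"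
proof -
  define l where "l = ((norm a)\<^sup>2 + 1) / (2 * Im c)"
  have l: "2 * (Im c * l) = (norm a)\<^sup>2 + 1" using im by (simp add: l_def)
  have "(norm (a + (\<i> * complex_of_real l) *\<^sub>C 1))\<^sup>2 < (cmod (c + \<i> * complex_of_real l))\<^sup>2"
  proof -
    have "(norm a)\<^sup>2 + l\<^sup>2 < (Re c)\<^sup>2 + (Im c)\<^sup>2 + 2 * (Im c * l) + l\<^sup>2"
      unfolding l by (smt (verit) zero_le_power2)
    also have "\<dots> = (cmod (c + \<i> * complex_of_real l))\<^sup>2"
      by (simp add: cmod_power2) (simp add: power2_eq_square algebra_simps)
    finally show ?thesis using norm_add_imaginary[OF sa, of l] by simp
  qed
  then have "norm (a + (\<i> * complex_of_real l) *\<^sub>C 1) < cmod (c + \<i> * complex_of_real l)"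
    using power_less_imp_less_base norm_ge_zero by blast
  from alg_invertible_scaleC_minus[OF this] show ?thesis
    by (simp add: scaleC_add_left algebra_simps)
qed

text \<open>Partial fractions. Iterated, this writes the resolvent of a \<open>2^k\<close>-th power
  as a mean of resolvents at points rotated by roots of unity.\<close>

lemma alg_inv_one_minus_square:
  fixes x :: "'a::real_algebra_1"
  assumes "alg_invertible (1 - x)" "alg_invertible (1 + x)"
  shows "alg_invertible (1 - x * x)"
    and "alg_inv (1 - x * x) = (1 / 2) *\<^sub>R (alg_inv (1 - x) + alg_inv (1 + x))"
proof -
  let ?P = "alg_inv (1 - x)" let ?Q = "alg_inv (1 + x)"
  have f: "1 - x * x = (1 + x) * (1 - x)" "1 - x * x = (1 - x) * (1 + x)" by (simp_all add: algebra_simps)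
  have "(1 - x * x) * ?P = 1 + x" "?P * (1 - x * x) = 1 + x"
    using assms f by (simp, metis alg_inv_cancel_assoc(2))
  moreover have "(1 - x * x) * ?Q = 1 - x" "?Q * (1 - x * x) = 1 - x"
    using assms f by (metis alg_inv_cancel_right(1), metis alg_inv_cancel_assoc(2))
  ultimately have "(1 - x * x) * ((1 / 2) *\<^sub>R (?P + ?Q)) = 1" "((1 / 2) *\<^sub>R (?P + ?Q)) * (1 - x * x) = 1"
    by (simp_all add: distrib_left distrib_right flip: scaleR_2)
  then show "alg_invertible (1 - x * x)" "alg_inv (1 - x * x) = (1 / 2) *\<^sub>R (?P + ?Q)"
    by (rule alg_invI)+
qed

text \<open>A mean of functions with a common modulus of continuity has the same modulus, so
  \<open>d\<close> and \<open>e\<close> survive every squaring unchanged.\<close>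

lemma uniform_modulus_resolvent_powers:
  fixes a :: "'a::cstar_algebra"
  assumes inv: "\<And>z. cmod z \<le> 1 \<Longrightarrow> alg_invertible (1 - z *\<^sub>C a)"
    and mod: "\<And>z w. \<lbrakk>cmod z \<le> 1; cmod w \<le> 1; cmod (z - w) < d\<rbrakk> \<Longrightarrow>
      norm (alg_inv (1 - z *\<^sub>C a) - alg_inv (1 - w *\<^sub>C a)) < e"
  shows "(\<forall>z. cmod z \<le> 1 \<longrightarrow> alg_invertible (1 - z ^ 2 ^ k *\<^sub>C a ^ 2 ^ k)) \<and>
    (\<forall>z w. cmod z \<le> 1 \<longrightarrow> cmod w \<le> 1 \<longrightarrow> cmod (z - w) < d \<longrightarrow>
      norm (alg_inv (1 - z ^ 2 ^ k *\<^sub>C a ^ 2 ^ k) - alg_inv (1 - w ^ 2 ^ k *\<^sub>C a ^ 2 ^ k)) < e)"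
proof (induction k)
  case 0
  then show ?case using inv mod by simp
next
  case (Suc k)
  define X where "X z = z ^ 2 ^ k *\<^sub>C a ^ 2 ^ k" for z
  \<comment> \<open>As \<open>u ^ 2 ^ k = -1\<close> and \<open>cmod u = 1\<close>, the factor
    \<open>1 + X z\<close> is \<open>1 - X (u * z)\<close>; the rotation keeps both the disc and
    distances, so the induction hypothesis applies to it.\<close>
  define u where "u = cis (pi / 2 ^ k)"
  have "u ^ 2 ^ k = cis (real (2 ^ k) * (pi / 2 ^ k))" unfolding u_def by (rule Complex.DeMoivre)
  then have u: "u ^ 2 ^ k = -1" "cmod u = 1" by (simp_all add: u_def)
  have sq: "z ^ 2 ^ Suc k *\<^sub>C a ^ 2 ^ Suc k = X z * X z" for z
    by (simp add: X_def mult_2 power_add mult_scaleC_left mult_scaleC_right scaleC_scaleC)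
  have rot: "1 + X z = 1 - X (u * z)" for z
    by (simp add: X_def power_mult_distrib u scaleC_minus_left)
  have i: "alg_invertible (1 - X z)" "alg_invertible (1 + X z)" if "cmod z \<le> 1" for z
    using Suc that unfolding rot by (auto simp: X_def norm_mult u)
  have m: "norm (alg_inv (1 - X z) - alg_inv (1 - X w)) < e" "norm (alg_inv (1 + X z) - alg_inv (1 + X w)) < e"
    if "cmod z \<le> 1" "cmod w \<le> 1" "cmod (z - w) < d" for z w
  proof -
    have "cmod (u * z - u * w) < d" using that u by (simp add: norm_mult flip: right_diff_distrib)
    then show "norm (alg_inv (1 - X z) - alg_inv (1 - X w)) < e" "norm (alg_inv (1 + X z) - alg_inv (1 + X w)) < e"
      using Suc that unfolding rot by (auto simp: X_def norm_mult u)
  qed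
  show ?case unfolding sq
  proof (intro conjI allI impI)
    fix z w assume A: "cmod z \<le> 1" "cmod w \<le> 1" "cmod (z - w) < d"
    have "alg_inv (1 - X z * X z) - alg_inv (1 - X w * X w) =
      (1/2) *\<^sub>R ((alg_inv (1 - X z) - alg_inv (1 - X w)) + (alg_inv (1 + X z) - alg_inv (1 + X w)))"
      using A by (simp add: alg_inv_one_minus_square i algebra_simps)
    also have "norm \<dots> \<le> (1/2) * (norm (alg_inv (1 - X z) - alg_inv (1 - X w)) + norm (alg_inv (1 + X z) - alg_inv (1 + X w)))"
      using norm_triangle_ineq by simp
    also have "\<dots> < e" using m[OF A] by simp
    finally show "norm (alg_inv (1 - X z * X z) - alg_inv (1 - X w * X w)) < e" .
  qed (use i alg_inv_one_minus_square in blast)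
qed

text \<open>Rickart's elementary argument: averaging the resolvent over roots of unity replaces
  Liouville's theorem. Doubling the order of the root suffices because
  \<open>norm (a ^ 2 ^ k) = norm a ^ 2 ^ k\<close> for self-adjoint \<open>a\<close>.\<close>

lemma self_adjoint_norm_in_spectrum:
  fixes a :: "'a::cstar_algebra"
  assumes sa: "self_adjoint a"
  shows "\<not> alg_invertible (a - of_real (norm a)) \<or> \<not> alg_invertible (a + of_real (norm a))"
proof -
  \<comment> \<open>If neither 1 nor -1 is in the spectrum, the resolvent exists on the whole closed
    disc and is uniformly continuous there by compactness. This modulus is inherited by the powers
    \<open>b\<close> of norm 1, for which it is absurd.\<close>
  have unit: False if sa: "self_adjoint a" and n: "norm a = 1" and i: "alg_invertible (1 - a)" "alg_invertible (1 + a)"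
    for a :: 'a
  proof -
    have inv: "alg_invertible (1 - z *\<^sub>C a)" if z: "cmod z \<le> 1" for z
    proof (cases "z = 0 \<or> z = 1 \<or> z = -1")
      case True
      then show ?thesis using i scaleC_of_real[of 0 a] by (auto simp: scaleC_minus_left)
    next
      case False
      have "alg_invertible (a - inverse z *\<^sub>C 1)"
      proof (cases "Im (inverse z) = 0")
        case True
        then have r: "inverse z = complex_of_real (Re (inverse z))" by (simp add: complex_eq_iff)
        have "cmod (inverse z) \<noteq> 1" using False True
          by (subst r) (metis r abs_if inverse_1 inverse_eq_iff_eq inverse_minus_eq minus_equation_iff norm_of_real of_real_1 of_real_minus real_norm_def)
        moreover have "cmod (inverse z) \<ge> 1" using z False by (simp add: norm_inverse one_le_inverse_iff)
        ultimately show ?thesis using n by (intro alg_invertible_scaleC_minus) simp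
      next
        case False
        then show ?thesis using self_adjoint_spectrum_real sa by blast
      qed
      moreover have "alg_invertible ((-z) *\<^sub>C (1::'a))"
        using False by (intro alg_invI[of _ "(- inverse z) *\<^sub>C 1"]) (auto simp: mult_scaleC_left scaleC_scaleC)
      ultimately have "alg_invertible ((-z) *\<^sub>C 1 * (a - inverse z *\<^sub>C 1))" using alg_invertible_mult by blast
      then show ?thesis using False
        by (simp add: mult_scaleC_left scaleC_diff_right scaleC_scaleC scaleC_minus_left)
    qed
    let ?g = "\<lambda>z. alg_inv (1 - z *\<^sub>C a)"
    have "continuous_on (cball 0 1) ?g"
    proof (rule continuous_onI)
      fix z and e :: real assume z: "z \<in> cball (0::complex) 1" and e: "0 < e"
      define R where "R = norm (?g z)"
      have R: "R \<ge> 0" by (simp add: R_def)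
      define d where "d = min (1 / (2 * (R + 1))) (e / (2 * R\<^sup>2 + 1))"
      have R2: "2 * R\<^sup>2 + 1 > 0" using zero_le_power2[of R] by linarith
      have d: "d > 0" using R R2 e by (simp add: d_def)
      show "\<exists>d>0. \<forall>w\<in>cball 0 1. dist w z < d \<longrightarrow> dist (?g w) (?g z) \<le> e"
      proof (intro exI conjI ballI impI)
        fix w assume w: "w \<in> cball (0::complex) 1" "dist w z < d"
        have n': "norm ((w - z) *\<^sub>C a) < d" using w n by (simp add: norm_scaleC dist_norm)
        have "norm ((w - z) *\<^sub>C a) * R \<le> d * (R + 1)" using n' R d by (intro mult_mono) auto
        also have "\<dots> \<le> 1 / (2 * (R + 1)) * (R + 1)" using R by (intro mult_right_mono) (auto simp: d_def)
        also have "\<dots> = 1 / 2" using R by (simp add: field_simps)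
        finally have "norm ((w - z) *\<^sub>C a) * norm (?g z) \<le> 1 / 2" by (simp add: R_def)
        from alg_invertible_perturb(2)[OF _ this] inv[of z] z
        have "norm (?g w - ?g z) \<le> 2 * R\<^sup>2 * norm ((w - z) *\<^sub>C a)"
          by (simp add: R_def scaleC_diff_left)
        also have "\<dots> \<le> (2 * R\<^sup>2 + 1) * d" using n' R2 by (intro mult_mono) auto
        also have "\<dots> \<le> (2 * R\<^sup>2 + 1) * (e / (2 * R\<^sup>2 + 1))" using R2 by (intro mult_left_mono) (auto simp: d_def)
        also have "\<dots> = e" using R2 by simp
        finally show "dist (?g w) (?g z) \<le> e" by (simp add: dist_norm)
      qed (rule d)
    qed
    then have "uniformly_continuous_on (cball 0 1) ?g" by (rule compact_uniformly_continuous) simp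
    then obtain d where d: "d > 0"
      and "\<forall>z\<in>cball 0 1. \<forall>w\<in>cball 0 1. dist w z < d \<longrightarrow> dist (?g w) (?g z) < 1/4"
      unfolding uniformly_continuous_on_def by (metis zero_less_divide_1_iff zero_less_numeral)
    then have "norm (?g z - ?g w) < 1/4" if "cmod z \<le> 1" "cmod w \<le> 1" "cmod (z - w) < d" for z w
      using that by (auto simp: dist_norm norm_minus_commute)
    note main = uniform_modulus_resolvent_powers[of a d "1/4", OF inv this]
    \<comment> \<open>The point \<open>s\<close> is within \<open>d\<close> of 1, so the modulus
      compares the resolvents at \<open>s\<close> and 1 for every \<open>k\<close>; yet
      \<open>s < 1\<close>, so \<open>s ^ 2 ^ k\<close> tends to 0 and the resolvent at
      \<open>s\<close> tends to 1.\<close>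
    define s where "s = max (1/2) (1 - d / 2)"
    have s: "0 < s" "s < 1" "1 - s < d" using d by (auto simp: s_def)
    have "(\<lambda>k. s ^ 2 ^ k) \<longlonglongrightarrow> 0"
      using LIMSEQ_subseq_LIMSEQ[OF LIMSEQ_realpow_zero[of s], of "\<lambda>k. 2 ^ k"] s
      by (simp add: o_def strict_mono_def)
    then obtain k where k: "s ^ 2 ^ k < 1/8"
      using order_tendstoD(2)[of _ 0 sequentially "1/8::real"] by (auto simp: eventually_sequentially)
    define b where "b = a ^ 2 ^ k"
    have nb: "norm b = 1" using norm_self_adjoint_power2[OF sa] n by (simp add: b_def)
    define t where "t = s ^ 2 ^ k"
    have "cmod (1 - complex_of_real s) < d" using s by (metis abs_of_pos diff_gt_0_iff_gt norm_of_real of_real_1 of_real_diff)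
  then have "norm (alg_inv (1 - 1 ^ 2 ^ k *\<^sub>C b) - alg_inv (1 - complex_of_real s ^ 2 ^ k *\<^sub>C b)) < 1/4"
      and "alg_invertible (1 - 1 ^ 2 ^ k *\<^sub>C b)"
      using conjunct2[OF main[of k], rule_format, of 1 "complex_of_real s"]
        conjunct1[OF main[of k], rule_format, of 1] s
      unfolding b_def by (simp_all only: norm_one norm_of_real order_refl)
    moreover have "complex_of_real s ^ 2 ^ k *\<^sub>C b = t *\<^sub>R b"
      by (simp only: t_def flip: of_real_power scaleC_of_real)
    ultimately have m: "norm (alg_inv (1 - b) - alg_inv (1 - t *\<^sub>R b)) < 1/4" and ib: "alg_invertible (1 - b)"
      by simp_all
    have tb: "norm (t *\<^sub>R b) < 1/8" using k s nb by (simp add: t_def)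
    have "norm (alg_inv (1 - t *\<^sub>R b) - alg_inv 1) \<le> 2 * (norm (alg_inv (1::'a)))\<^sup>2 * norm (t *\<^sub>R b)"
      using tb by (intro alg_invertible_perturb(2)) auto
    then have "norm (alg_inv (1 - t *\<^sub>R b) - 1) < 1/4" using tb by simp
    then have c: "norm (alg_inv (1 - b) - 1) < 1/2" using m norm_triangle_ineq[of "alg_inv (1 - b) - alg_inv (1 - t *\<^sub>R b)" "alg_inv (1 - t *\<^sub>R b) - 1"]
      by simp
    \<comment> \<open>The right side has norm below \<open>2 * (1 / 2)\<close>, against
      \<open>norm b = 1\<close>.\<close>
    have "b = (1 - b) * (alg_inv (1 - b) - 1)" using ib by (simp add: right_diff_distrib)
    then have "norm b \<le> norm (1 - b) * norm (alg_inv (1 - b) - 1)" by (metis norm_mult_ineq)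
    also have "\<dots> \<le> 2 * norm (alg_inv (1 - b) - 1)"
      using norm_triangle_ineq4[of 1 b] nb by (intro mult_right_mono) auto
    finally show False using nb c by simp
  qed
  show ?thesis
  proof (cases "a = 0")
    case True
    then show ?thesis by (simp add: alg_invertible_def)
  next
    case False
    define b where "b = inverse (norm a) *\<^sub>R a"
    have b: "self_adjoint b" "norm b = 1" using sa False by (simp_all add: b_def)
    have *: "a - of_real (norm a) = (- norm a) *\<^sub>R (1 - b)" "a + of_real (norm a) = norm a *\<^sub>R (1 + b)"
      using False by (simp_all add: b_def of_real_def algebra_simps)
    show ?thesis unfolding * using unit[OF b] False alg_invertible_scaleR[of "- norm a" "1 - b"]
      alg_invertible_scaleR[of "norm a" "1 + b"] by auto
  qed
qed

section \<open>Positive elements and square roots\<close>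

text \<open>The spectrum of a self-adjoint element is real, so only the negative reals
  \<open>- r\<close> have to be excluded. This is the working form of positivity from here
  on.\<close>

lemma cstar_positive_iff:
  "cstar_positive a \<longleftrightarrow> self_adjoint a \<and> (\<forall>r>0. alg_invertible (a + of_real r))"
proof -
  have *: "a - complex_of_real (- r) *\<^sub>C 1 = a + of_real r" for r
    unfolding scaleC_of_real_one by simp
  show ?thesis
  proof (intro iffI conjI allI impI)
    assume p: "cstar_positive a"
    then show "self_adjoint a" by (simp add: cstar_positive_def)
    fix r :: real assume "0 < r"
    then have "complex_of_real (- r) \<notin> cstar_spectrum a" using p
      unfolding cstar_positive_def by (auto simp flip: of_real_minus)
    then show "alg_invertible (a + of_real r)" unfolding cstar_spectrum_def mem_Collect_eq * by simp
  next
    assume A: "self_adjoint a \<and> (\<forall>r>0. alg_invertible (a + of_real r))"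
    have "\<exists>r\<ge>0. c = complex_of_real r" if "c \<in> cstar_spectrum a" for c
    proof -
      have "Im c = 0" using A that self_adjoint_spectrum_real unfolding cstar_spectrum_def by blast
      then have c: "c = complex_of_real (- (- Re c))" by (simp add: complex_eq_iff)
      have "\<not> alg_invertible (a + of_real (- Re c))"
        using that unfolding cstar_spectrum_def *[symmetric] c[symmetric] by simp
      then have "Re c \<ge> 0" using A by (meson neg_0_less_iff_less not_le)
      then show ?thesis using c by auto
    qed
    then show "cstar_positive a" using A unfolding cstar_positive_def by blast
  qed
qed

lemma pos_self_adjoint: "cstar_positive a \<Longrightarrow> self_adjoint a"
  by (simp add: cstar_positive_def)

lemma pos_of_real [simp]: "0 \<le> r \<Longrightarrow> cstar_positive (of_real r)"
proof -
  assume "0 \<le> r"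
  moreover have "alg_invertible (of_real s :: 'a)" if "s > 0" for s
    using that alg_invertible_scaleR[of s "1::'a"] by (simp add: of_real_def)
  ultimately show ?thesis by (auto simp: cstar_positive_iff simp flip: of_real_add)
qed

lemma pos_0 [simp]: "cstar_positive 0" and pos_1 [simp]: "cstar_positive 1"
  using pos_of_real[of 0] pos_of_real[of 1] by simp_all

lemma pos_scaleR:
  assumes "cstar_positive a" "0 \<le> r"
  shows "cstar_positive (r *\<^sub>R a)"
proof (cases "r = 0")
  case False
  have "r *\<^sub>R a + of_real s = r *\<^sub>R (a + of_real (s / r))" for s
    using False by (simp add: of_real_def algebra_simps)
  then show ?thesis using assms False unfolding cstar_positive_iff
    by (simp add: alg_invertible_scaleR del: of_real_divide)
qed simp

lemma norm_le_imp_pos: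
  assumes "self_adjoint a" "norm a \<le> t"
  shows "cstar_positive (of_real t - a)" "cstar_positive (of_real t + a)"
proof -
  have i: "alg_invertible (a - of_real r)" "alg_invertible (a + of_real r)" if "r > t" for r
  proof -
    have "norm a < cmod (complex_of_real r)" "norm a < cmod (complex_of_real (- r))"
      using that assms by simp_all
    then show "alg_invertible (a - of_real r)" "alg_invertible (a + of_real r)"
      using alg_invertible_scaleC_minus[of a "complex_of_real r"] alg_invertible_scaleC_minus[of a "complex_of_real (- r)"]
      unfolding scaleC_of_real_one by simp_all
  qed
  have *: "of_real t - a + of_real r = - (a - of_real (t + r))" "of_real t + a + of_real r = a + of_real (t + r)" for r
    by simp_all
  show "cstar_positive (of_real t - a)" "cstar_positive (of_real t + a)"
    unfolding cstar_positive_iff * alg_invertible_minus using assms i by (simp_all del: of_real_add)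
qed

text \<open>The bridge between norm and order. Were \<open>norm a > t\<close>, both order bounds
  would make \<open>a - norm a\<close> and \<open>a + norm a\<close> invertible, but one of these
  numbers is in the spectrum.\<close>

lemma norm_le_iff:
  assumes "self_adjoint a"
  shows "norm a \<le> t \<longleftrightarrow> cstar_positive (of_real t - a) \<and> cstar_positive (of_real t + a)"
proof (rule iffI)
  assume A: "cstar_positive (of_real t - a) \<and> cstar_positive (of_real t + a)"
  show "norm a \<le> t"
  proof (rule ccontr)
    assume n: "\<not> norm a \<le> t"
    then have "norm a - t > 0" by simp
    then have "alg_invertible (of_real t - a + of_real (norm a - t))" "alg_invertible (of_real t + a + of_real (norm a - t))"
      using A unfolding cstar_positive_iff by (simp_all del: of_real_diff)
    then have "alg_invertible (- (a - of_real (norm a)))" "alg_invertible (a + of_real (norm a))"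
      by (simp_all add: algebra_simps)
    then show False using self_adjoint_norm_in_spectrum[OF assms] alg_invertible_minus by blast
  qed
qed (use norm_le_imp_pos assms in blast)

lemma pos_norm_bounds:
  assumes "self_adjoint a"
  shows "cstar_positive (of_real (norm a) - a)" "cstar_positive (of_real (norm a) + a)"
  using norm_le_imp_pos[OF assms order_refl] by auto

text \<open>Positivity of \<open>x\<close> gives that \<open>norm x - x\<close> has norm at most
  \<open>norm x\<close>, and a bound of this shape, with any constant in place of
  \<open>norm x\<close>, gives positivity back. Such bounds add up by the triangle
  inequality.\<close>

lemma pos_add:
  assumes a: "cstar_positive a" and b: "cstar_positive b"
  shows "cstar_positive (a + b)"
proof -
  have *: "norm (of_real (norm x) - x) \<le> norm x" if "cstar_positive x" for x :: 'a
  proof -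
    have "cstar_positive (of_real (2 * norm x) - x)"
      using norm_le_imp_pos(1)[of x "2 * norm x"] that pos_self_adjoint[OF that] by simp
    moreover have "of_real (2 * norm x) - x = of_real (norm x) + (of_real (norm x) - x)"
      by (simp only: mult_2 of_real_add add_diff_eq)
    moreover have "self_adjoint (of_real (norm x) - x)" using pos_self_adjoint[OF that] by simp
    ultimately show ?thesis using that norm_le_iff[of "of_real (norm x) - x" "norm x"]
      by (simp add: add_diff_eq)
  qed
  let ?x = "(of_real (norm a) - a) + (of_real (norm b) - b)"
  have "norm ?x \<le> norm a + norm b" by (rule norm_triangle_mono[OF *[OF a] *[OF b]])
  moreover have "self_adjoint ?x" using pos_self_adjoint[OF a] pos_self_adjoint[OF b] by simp
  ultimately have "cstar_positive (of_real (norm a + norm b) - ?x)" by (rule norm_le_imp_pos(1)[rotated])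
  moreover have "of_real (norm a + norm b) - ?x = a + b" by (simp only: of_real_add) simp
  ultimately show ?thesis by metis
qed

lemma cle_trans:
  assumes "a \<sqsubseteq> b" "b \<sqsubseteq> c"
  shows "a \<sqsubseteq> c"
  using pos_add[OF assms(2,1)] by simp

lemma cle_antisym:
  assumes "a \<sqsubseteq> b" "b \<sqsubseteq> a"
  shows "a = b"
proof -
  have "norm (b - a) \<le> 0"
    by (subst norm_le_iff[OF pos_self_adjoint[OF assms(1)]]) (simp add: assms)
  then show ?thesis by simp
qed

text \<open>Used to pass from invertible positive elements, which have inverses and roots at hand,
  to all positive ones.\<close>

lemma pos_archimedean:
  assumes "\<And>e. e > 0 \<Longrightarrow> cstar_positive (x + of_real e)"
  shows "cstar_positive x"
proof -
  have "self_adjoint x" using pos_self_adjoint[OF assms[of 1]] by simp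
  moreover have "alg_invertible (x + of_real r)" if "r > 0" for r
  proof -
    have "r / 2 > 0" using that by simp
    with assms[OF this] have "alg_invertible (x + of_real (r/2) + of_real (r/2))"
      unfolding cstar_positive_iff by blast
    moreover have "x + of_real (r/2) + of_real (r/2) = x + of_real r"
      by (simp only: add.assoc field_sum_of_halves flip: of_real_add)
    ultimately show ?thesis by simp
  qed
  ultimately show ?thesis by (simp add: cstar_positive_iff)
qed

lemma pos_norm_le_iff:
  assumes "cstar_positive p" "0 \<le> t"
  shows "norm p \<le> t \<longleftrightarrow> p \<sqsubseteq> of_real t"
  using norm_le_iff[OF pos_self_adjoint[OF assms(1)]] pos_add[OF pos_of_real[OF assms(2)] assms(1)] by metis

section \<open>The positive definite cone, conjugation and square roots\<close>

lemma cone_pos: "x \<in> pos_def_cone \<Longrightarrow> cstar_positive x"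
  and cone_invertible [simp]: "x \<in> pos_def_cone \<Longrightarrow> alg_invertible x"
  and cone_self_adjoint [simp]: "x \<in> pos_def_cone \<Longrightarrow> self_adjoint x"
  by (simp_all add: pos_def_cone_def cstar_positive_def)

lemma coneI: "cstar_positive x \<Longrightarrow> alg_invertible x \<Longrightarrow> x \<in> pos_def_cone"
  unfolding pos_def_cone_def by simp

lemma cone_ge:
  assumes "of_real r \<sqsubseteq> x" "0 < r"
  shows "x \<in> pos_def_cone"
proof -
  have "cstar_positive x" using pos_add[OF assms(1) pos_of_real[of r]] assms by simp
  moreover have "alg_invertible (x - of_real r + of_real r)" using assms unfolding cstar_positive_iff by blast
  ultimately show ?thesis by (auto intro: coneI)
qed

lemma cone_bounded_below:
  assumes "x \<in> pos_def_cone"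
  obtains r :: real where "0 < r" "of_real r \<sqsubseteq> x"
proof -
  \<comment> \<open>For \<open>0 \<le> t \<le> s\<close> the perturbation bound keeps
    \<open>x - t\<close> invertible, so the spectrum has a gap above 0; the \<open>+ 1\<close>
    avoids dividing by zero.\<close>
  define s where "s = 1 / (2 * (norm (alg_inv x) + 1))"
  have n: "norm (alg_inv x) + 1 > 0" by (simp add: add_nonneg_pos)
  then have s: "0 < s" by (simp add: s_def)
  have i: "alg_invertible (x - of_real t)" if "0 \<le> t" "t \<le> s" for t
  proof (rule alg_invertible_perturb)
    have "t * norm (alg_inv x) \<le> s * (norm (alg_inv x) + 1)" using that s n by (intro mult_mono) auto
    also have "\<dots> = 1 / 2" using n by (simp add: s_def)
    finally show "norm (of_real t :: 'a) * norm (alg_inv x) \<le> 1 / 2" using that by simp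
  qed (use assms in simp)
  have "alg_invertible (x - of_real s + of_real r)" if "0 < r" for r
  proof (cases "r \<le> s")
    case True
    then have "alg_invertible (x - of_real (s - r))" using i[of "s - r"] that by simp
    then show ?thesis by (simp add: diff_diff_eq2 diff_add_eq)
  next
    case False
    then have "r - s > 0" by simp
    then have "alg_invertible (x + of_real (r - s))" using cone_pos[OF assms] unfolding cstar_positive_iff by blast
    then show ?thesis by (simp add: add_diff_eq diff_add_eq)
  qed
  moreover have "self_adjoint (x - of_real s)" using assms by simp
  ultimately have "of_real s \<sqsubseteq> x" unfolding cstar_positive_iff by blast
  then show ?thesis using that[OF s] by simp
qed

lemma cone_add:
  assumes "x \<in> pos_def_cone" "cstar_positive y"
  shows "x + y \<in> pos_def_cone"
proof -
  obtain r :: real where "0 < r" "of_real r \<sqsubseteq> x" using cone_bounded_below assms by blast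
  then show ?thesis using pos_add[of "x - of_real r" y] assms(2) cone_ge[of "x + y" r]
    by (simp add: diff_add_eq)
qed

lemma cone_of_real [simp]: "0 < r \<Longrightarrow> of_real r \<in> pos_def_cone"
  by (rule cone_ge[of _ r]) simp_all

lemma cone_1 [simp]: "1 \<in> pos_def_cone"
  using cone_of_real[of 1] by simp

lemma cone_scaleR:
  assumes "x \<in> pos_def_cone" "0 < r"
  shows "r *\<^sub>R x \<in> pos_def_cone"
  using assms by (intro coneI pos_scaleR) (simp_all add: cone_pos alg_invertible_scaleR)

lemma cone_add_of_real:
  assumes "self_adjoint x" "norm x < r"
  shows "x + of_real r \<in> pos_def_cone"
proof (rule cone_ge)
  have "x + of_real r - of_real (r - norm x) = of_real (norm x) + x" by (simp only: of_real_diff) simp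
  then show "of_real (r - norm x) \<sqsubseteq> x + of_real r" using assms pos_norm_bounds(2) by metis
qed (use assms in simp)

lemma cone_alg_inv:
  assumes x: "x \<in> pos_def_cone"
  shows "alg_inv x \<in> pos_def_cone"
proof -
  have "alg_invertible (alg_inv x + of_real r)" if "0 < r" for r
  proof -
    have "alg_inv x + of_real r = alg_inv x * (r *\<^sub>R (x + of_real (1 / r)))"
      using that x by (simp add: of_real_def algebra_simps)
    moreover have "alg_invertible (x + of_real (1 / r))"
      using cone_pos[OF x] that unfolding cstar_positive_iff by (simp del: of_real_divide)
    ultimately show ?thesis using that x by (simp add: alg_invertible_mult alg_invertible_scaleR del: of_real_divide)
  qed
  moreover have "self_adjoint (alg_inv x)" using alg_inv_adj(2)[of x] x by simp
  ultimately show ?thesis using x by (intro coneI) (simp_all add: cstar_positive_iff)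
qed

text \<open>Factor \<open>x^2 + r = (x - i sqrt r)(x + i sqrt r)\<close>; both factors are
  invertible because the spectrum of \<open>x\<close> is real.\<close>

lemma pos_square:
  assumes x: "self_adjoint x"
  shows "cstar_positive (x * x)"
proof -
  have "alg_invertible (x * x + of_real r)" if "0 < r" for r
  proof -
    define s where "s = sqrt r"
    have s: "s > 0" "s * s = r" using that by (simp_all add: s_def)
    let ?c = "\<i> * complex_of_real s"
    have "(x - ?c *\<^sub>C 1) * (x - (- ?c) *\<^sub>C 1) = x * x - (?c * ?c) *\<^sub>C 1"
      by (simp add: algebra_simps mult_scaleC_left mult_scaleC_right scaleC_scaleC scaleC_minus_left scaleC_diff_right scaleC_add_right)
    also have "?c * ?c = complex_of_real (- r)" by (simp add: complex_eq_iff s)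
    finally have "x * x + of_real r = (x - ?c *\<^sub>C 1) * (x - (- ?c) *\<^sub>C 1)"
      unfolding scaleC_of_real_one by simp
    moreover have "alg_invertible (x - ?c *\<^sub>C 1)" "alg_invertible (x - (- ?c) *\<^sub>C 1)"
      using s x by (auto intro!: self_adjoint_spectrum_real)
    ultimately show ?thesis using alg_invertible_mult by metis
  qed
  then show ?thesis using x by (simp add: cstar_positive_iff cstar_adj_mult)
qed

text \<open>For invertible \<open>p\<close>, swapping factors reduces the claim to
  \<open>p * x * x + r = p * (r *\<^sub>R alg_inv p + x * x)\<close>, where the second factor is in
  the cone. A general \<open>p\<close> is approximated by \<open>of_real d + p\<close>.\<close>

lemma pos_conj:
  assumes x: "self_adjoint x" and p: "cstar_positive p"
  shows "cstar_positive (x * p * x)"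
proof -
  have cone: "cstar_positive (x * p * x)" if p: "p \<in> pos_def_cone" for p
  proof -
    have "alg_invertible (x * (p * x) + of_real r)" if "0 < r" for r
    proof (rule alg_invertible_add_swap)
      have "p * x * x + of_real r = p * (r *\<^sub>R alg_inv p + x * x)"
        using p by (simp add: of_real_def algebra_simps)
      moreover have "r *\<^sub>R alg_inv p + x * x \<in> pos_def_cone"
        using that p x by (simp add: cone_add cone_scaleR cone_alg_inv pos_square)
      ultimately show "alg_invertible (p * x * x + of_real r)" using p alg_invertible_mult by force
    qed (use that in auto)
    then show ?thesis using x p by (simp add: cstar_positive_iff cstar_adj_mult mult.assoc)
  qed
  show ?thesis
  proof (rule pos_archimedean)
    fix e :: real assume e: "e > 0"
    \<comment> \<open>Chosen so that the error \<open>d *\<^sub>R (x * x)\<close> has norm at most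
      \<open>e\<close>.\<close>
    define d where "d = e / ((norm x)\<^sup>2 + 1)"
    have n: "(norm x)\<^sup>2 + 1 > 0" by (simp add: add_nonneg_pos)
    then have d: "d > 0" using e by (simp add: d_def)
    have "of_real d + p \<in> pos_def_cone" using d p cone_add cone_of_real by blast
    then have 1: "cstar_positive (x * (of_real d + p) * x)" by (rule cone)
    have "d * (norm x)\<^sup>2 \<le> e" using e n by (simp add: d_def field_simps)
    then have "norm (d *\<^sub>R (x * x)) \<le> e" using d x by (simp add: norm_self_adjoint_square)
    then have "cstar_positive (of_real e - d *\<^sub>R (x * x))"
      using x by (intro norm_le_imp_pos) (auto simp: cstar_adj_mult)
    from pos_add[OF 1 this] show "cstar_positive (x * p * x + of_real e)"
      by (simp add: of_real_def algebra_simps)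
  qed
qed

lemma alg_inv_self_adjoint: "alg_invertible x \<Longrightarrow> self_adjoint x \<Longrightarrow> self_adjoint (alg_inv x)"
  using alg_inv_adj(2)[of x] by simp

lemma pos_conj_iff:
  assumes "self_adjoint x" "alg_invertible x"
  shows "cstar_positive (x * p * x) \<longleftrightarrow> cstar_positive p"
proof -
  have "alg_inv x * (x * p * x) * alg_inv x = p" using assms by (simp add: mult.assoc)
  then show ?thesis using pos_conj assms alg_inv_self_adjoint by metis
qed

lemma cone_conj:
  assumes "self_adjoint x" "alg_invertible x" "p \<in> pos_def_cone"
  shows "x * p * x \<in> pos_def_cone"
  using assms by (intro coneI pos_conj alg_invertible_mult) (simp_all add: cone_pos)

text \<open>The square root of \<open>1 - b\<close> is \<open>1 - y\<close> for the fixed point \<open>y\<close> of \<open>y \<mapsto> (b + y\<^sup>2) / 2\<close>.\<close>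

lemma cone_sqrt_exists:
  assumes p: "p \<in> pos_def_cone"
  shows "\<exists>q\<in>pos_def_cone. q * q = p \<and> (\<forall>z. z * p = p * z \<longrightarrow> z * q = q * z)"
proof -
  obtain s where s: "0 < s" "of_real s \<sqsubseteq> p" using cone_bounded_below p by blast
  \<comment> \<open>Dividing by \<open>N\<close> places \<open>p\<close> between
    \<open>s / N\<close> and 1, hence \<open>b = 1 - p / N\<close> between 0 and
    \<open>r = 1 - s / N < 1\<close>.\<close>
  define N where "N = norm p + s"
  have N: "N > 0" "s \<le> N" using s by (auto simp: N_def add_nonneg_pos)
  define b where "b = 1 - (1 / N) *\<^sub>R p"
  define r where "r = 1 - s / N"
  have r: "0 \<le> r" "r < 1" using N s by (simp_all add: r_def)
  have sab: "self_adjoint b" using p by (simp add: b_def)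
  have "cstar_positive ((1/N) *\<^sub>R (p - of_real s))" using s N by (intro pos_scaleR) auto
  moreover have "cstar_positive ((1/N) *\<^sub>R (of_real (norm p) - p) + of_real (s / N + r))"
    using N s r p by (intro pos_add pos_scaleR pos_norm_bounds pos_of_real) auto
  moreover have "(1/N) *\<^sub>R (p - of_real s) = of_real r - b"
    by (simp add: b_def r_def of_real_def algebra_simps)
  moreover have "(1/N) *\<^sub>R (of_real (norm p) - p) + of_real (s / N + r) = of_real r + b"
  proof -
    have "(1/N) *\<^sub>R (of_real (norm p) - p) + of_real (s / N + r) = of_real (norm p / N + s / N + r) - (1/N) *\<^sub>R p"
      by (simp add: of_real_def algebra_simps)
    also have "norm p / N + s / N + r = 1 + r" using N by (simp add: N_def flip: add_divide_distrib)
    finally show ?thesis by (simp add: b_def)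
  qed
  ultimately have nb: "norm b \<le> r" using norm_le_iff[OF sab] by metis
  \<comment> \<open>Self-adjointness and commutation with everything that commutes with
    \<open>b\<close> are closed conditions stable under \<open>f\<close>; built into the domain,
    they hold for the fixed point. On the ball of radius \<open>r\<close> the map contracts by
    \<open>r\<close>.\<close>
  define S where "S = {y. norm y \<le> r \<and> self_adjoint y \<and> (\<forall>z. z * b = b * z \<longrightarrow> z * y = y * z)}"
  define f where "f y = (1/2) *\<^sub>R (b + y * y)" for y
  have "\<exists>!y. y \<in> S \<and> f y = y"
  proof (rule Banach_fix)
    have "S = {y. norm y \<le> r} \<inter> {y. self_adjoint y} \<inter> (\<Inter>z\<in>{z. z * b = b * z}. {y. z * y = y * z})"
      by (auto simp: S_def)
    moreover have "closed \<dots>"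
      by (intro closed_Int closed_INT ballI closed_Collect_le closed_Collect_eq continuous_intros)
    ultimately show "complete S" by (simp add: complete_eq_closed)
    show "S \<noteq> {}" using r by (auto simp: S_def intro!: exI[of _ 0])
    show "f ` S \<subseteq> S"
    proof safe
      fix y assume y: "y \<in> S"
      have "norm (f y) \<le> (1/2) * (norm b + norm (y * y))"
        unfolding f_def using norm_triangle_ineq[of b "y * y"] by simp
      also have "norm (y * y) \<le> r * r"
        using y r by (intro order_trans[OF norm_mult_ineq] mult_mono) (auto simp: S_def)
      also have "r * r \<le> r" using r by (simp add: mult_left_le)
      finally have "norm (f y) \<le> r" using nb by simp
      moreover have "z * f y = f y * z" if "z * b = b * z" for z
      proof -
        have "z * y = y * z" using that y by (auto simp: S_def)
        then have "z * (y * y) = y * y * z" by (metis mult.assoc)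
        then show ?thesis using that by (simp add: f_def distrib_left distrib_right)
      qed
      moreover have "self_adjoint y" using y unfolding S_def by blast
      then have "self_adjoint (f y)" using sab by (simp add: f_def cstar_adj_mult)
      ultimately show "f y \<in> S" unfolding S_def by blast
    qed
    show "dist (f x) (f y) \<le> r * dist x y" if "x \<in> S" "y \<in> S" for x y
    proof -
      have "f x - f y = (1/2) *\<^sub>R (x * (x - y) + (x - y) * y)" by (simp add: f_def algebra_simps)
      then have "norm (f x - f y) \<le> (1/2) * (norm (x * (x - y)) + norm ((x - y) * y))"
        using norm_triangle_ineq by simp
      moreover have "norm (x * (x - y)) \<le> r * norm (x - y)" "norm ((x - y) * y) \<le> norm (x - y) * r"
        using that r by (auto simp: S_def intro!: order_trans[OF norm_mult_ineq] mult_mono)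
      ultimately show ?thesis by (simp add: dist_norm algebra_simps)
    qed
  qed (use r in auto)
  then obtain y where y: "y \<in> S" "f y = y" by blast
  have "2 *\<^sub>R f y = b + y * y" by (simp add: f_def)
  then have yy: "b + y * y = 2 *\<^sub>R y" using y by simp
  have c1: "1 - y \<in> pos_def_cone"
  proof (rule cone_ge)
    show "of_real (1 - r) \<sqsubseteq> 1 - y" using norm_le_imp_pos(1)[of y r] y by (simp add: S_def algebra_simps)
  qed (use r in simp)
  let ?q = "sqrt N *\<^sub>R (1 - y)"
  have "?q \<in> pos_def_cone" using c1 N by (intro cone_scaleR) auto
  moreover have "?q * ?q = p"
  proof -
    have "(1 - y) * (1 - y) = 1 - 2 *\<^sub>R y + y * y" by (simp add: algebra_simps scaleR_2)
    also have "\<dots> = (1 / N) *\<^sub>R p" by (simp add: b_def algebra_simps flip: yy)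
    finally have "(1 - y) * (1 - y) = (1 / N) *\<^sub>R p" .
    then show ?thesis using N by simp
  qed
  moreover have "z * ?q = ?q * z" if "z * p = p * z" for z
  proof -
    have "z * b = b * z" using that by (simp add: b_def algebra_simps)
    then have "z * y = y * z" using y by (auto simp: S_def)
    then show ?thesis by (simp add: algebra_simps)
  qed
  ultimately show ?thesis by blast
qed

text \<open>Any positive root \<open>c\<close> commutes with its square, hence with the constructed
  root \<open>r\<close>, so \<open>(c - r) * (r + c) = 0\<close> with \<open>r + c\<close>
  invertible.\<close>

lemma cone_sqrt_unique:
  assumes q: "q \<in> pos_def_cone" and b: "cstar_positive b" and eq: "b * b = q * q"
  shows "b = q"
proof -
  have p: "q * q \<in> pos_def_cone"
    using q by (intro coneI pos_square alg_invertible_mult) simp_all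
  obtain r where r: "r \<in> pos_def_cone" "r * r = q * q" and comm: "\<And>z. z * (q * q) = (q * q) * z \<Longrightarrow> z * r = r * z"
    using cone_sqrt_exists[OF p] by blast
  have *: "c = r" if c: "cstar_positive c" "c * c = q * q" for c
  proof -
    have "c * r = r * c" using c by (intro comm) (metis mult.assoc)
    then have "(c - r) * (r + c) = 0" using c r by (simp add: algebra_simps)
    moreover have "alg_invertible (r + c)" using cone_add[of r c] r c by simp
    ultimately have "(c - r) * (r + c) * alg_inv (r + c) = 0" by simp
    then show ?thesis using \<open>alg_invertible (r + c)\<close> by (simp add: mult.assoc)
  qed
  show ?thesis using *[OF b eq] *[OF cone_pos[OF q] refl] by simp
qed

lemma pos_sqrt_eq:
  assumes "q \<in> pos_def_cone"
  shows "pos_sqrt (q * q) = q"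
  unfolding pos_sqrt_def
  by (rule the_equality) (use assms cone_sqrt_unique cone_pos in \<open>auto simp: power2_eq_square\<close>)

lemma pos_sqrt_cone:
  assumes "p \<in> pos_def_cone"
  shows "pos_sqrt p \<in> pos_def_cone" "pos_sqrt p * pos_sqrt p = p"
  using cone_sqrt_exists[OF assms] pos_sqrt_eq by metis+

text \<open>The root \<open>q\<close> of \<open>of_real d + h\<close> commutes with \<open>k\<close>
  too, so \<open>(of_real d + h) * k = q * k * q\<close> is a conjugate of \<open>k\<close>.\<close>

lemma pos_mult_commuting:
  assumes h: "cstar_positive h" and k: "cstar_positive k" and comm: "h * k = k * h"
  shows "cstar_positive (h * k)"
proof (rule pos_archimedean)
  fix e :: real assume e: "e > 0"
  define d where "d = e / (norm k + 1)"
  have n: "norm k + 1 > 0" by (simp add: add_nonneg_pos)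
  then have d: "d > 0" using e by (simp add: d_def)
  have "of_real d + h \<in> pos_def_cone" using d h cone_add cone_of_real by blast
  then obtain q where q: "q \<in> pos_def_cone" "q * q = of_real d + h"
      and "\<forall>z. z * (of_real d + h) = (of_real d + h) * z \<longrightarrow> z * q = q * z"
    using cone_sqrt_exists by blast
  moreover have "k * (of_real d + h) = (of_real d + h) * k" using comm by (simp add: algebra_simps of_real_def)
  ultimately have qk: "k * q = q * k" by blast
  have "q * k * q = (of_real d + h) * k" using q(2) qk by (metis mult.assoc)
  then have 1: "cstar_positive ((of_real d + h) * k)" using pos_conj[of q k] q k by simp
  have "d * norm k \<le> e" using e n by (simp add: d_def field_simps)
  then have "cstar_positive (of_real e - d *\<^sub>R k)"
    using d k pos_self_adjoint by (intro norm_le_imp_pos) auto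
  from pos_add[OF 1 this] show "cstar_positive (h * k + of_real e)"
    by (simp add: of_real_def algebra_simps)
qed

lemma gauge_norm_iff:
  assumes x: "x \<in> pos_def_cone" and y: "y \<in> pos_def_cone" and c: "0 \<le> c"
  shows "norm (x * alg_inv y) \<le> c \<longleftrightarrow> x * x \<sqsubseteq> c\<^sup>2 *\<^sub>R (y * y)"
proof -
  let ?z = "x * alg_inv y" let ?i = "alg_inv y"
  have i: "self_adjoint ?i" "alg_invertible ?i" using y by (simp_all add: alg_inv_self_adjoint)
  have "cstar_adj ?z * ?z = ?i * (x * x) * ?i" using x i by (simp add: cstar_adj_mult mult.assoc)
  then have n: "(norm ?z)\<^sup>2 = norm (?i * (x * x) * ?i)" using cstar_identity[of ?z] by simp
  have "norm ?z \<le> c \<longleftrightarrow> (norm ?z)\<^sup>2 \<le> c\<^sup>2" using c by (simp add: power2_le_iff_abs_le)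
  also have "\<dots> \<longleftrightarrow> cstar_positive (of_real (c\<^sup>2) - ?i * (x * x) * ?i)"
    unfolding n using i x by (intro pos_norm_le_iff pos_conj pos_square) auto
  also have "of_real (c\<^sup>2) - ?i * (x * x) * ?i = ?i * (c\<^sup>2 *\<^sub>R (y * y) - x * x) * ?i"
    using y by (simp add: algebra_simps of_real_def)
  also have "cstar_positive \<dots> \<longleftrightarrow> x * x \<sqsubseteq> c\<^sup>2 *\<^sub>R (y * y)" by (rule pos_conj_iff[OF i])
  finally show ?thesis .
qed

section \<open>Gauge-preserving maps are additive\<close>

lemma pos_scaleR_cancel:
  assumes "cstar_positive (r *\<^sub>R x)" "0 < r"
  shows "cstar_positive x"
  using pos_scaleR[OF assms(1), of "inverse r"] assms(2) by simp

text \<open>The order on a \<open>C\<^sup>*\<close>-algebra is detected by the gauges \<open>z \<mapsto> inf {t. z \<sqsubseteq> t y}\<close>. The element \<open>y\<close> that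
  separates \<open>c\<close> from \<open>a + b\<close> approximates a point at which a state \<open>f\<close> with
  \<open>f (c - a - b) > 0\<close> is concentrated: \<open>\<delta>\<close>, \<open>\<alpha>\<close>, \<open>\<beta>\<close> below are the successive values at \<open>c - a - b\<close>,
  \<open>a\<close>, \<open>b\<close> of a state extremal for these three elements, as in the proof of the Hahn--Banach
  theorem.\<close>

lemma gauge_separation:
  fixes a b c :: "'a::cstar_algebra"
  assumes a: "a \<in> pos_def_cone" and b: "b \<in> pos_def_cone" and c: "self_adjoint c"
    and gauge: "\<And>y s t. \<lbrakk>y \<in> pos_def_cone; 0 < s; 0 < t; a \<sqsubseteq> s *\<^sub>R y; b \<sqsubseteq> t *\<^sub>R y\<rbrakk> \<Longrightarrow> c \<sqsubseteq> (s + t) *\<^sub>R y"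
  shows "c \<sqsubseteq> a + b"
proof (rule ccontr)
  assume nle: "\<not> c \<sqsubseteq> a + b"
  define d where "d = c - a - b"
  have sad: "self_adjoint d" using a b c by (simp add: d_def)
  \<comment> \<open>Adding \<open>norm d\<close> makes the element positive, so its norm is the top
    of its spectrum: \<open>\<delta>\<close> is the largest spectral value of \<open>d\<close>, and
    \<open>m\<close> is positive with 0 in its spectrum.\<close>
  define M where "M = norm (d + of_real (norm d))"
  define \<delta> where "\<delta> = M - norm d"
  define m where "m = of_real \<delta> - d"
  have sad': "self_adjoint (d + of_real (norm d))" using sad by simp
  have "cstar_positive (of_real M - (d + of_real (norm d)))"
    unfolding M_def by (rule pos_norm_bounds(1)[OF sad'])
  also have "of_real M - (d + of_real (norm d)) = m" by (simp add: m_def \<delta>_def)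
  finally have m: "cstar_positive m" .
  have \<delta>: "\<delta> > 0"
  proof (rule ccontr)
    assume "\<not> \<delta> > 0"
    then have "cstar_positive (m + of_real (- \<delta>))" using m by (intro pos_add pos_of_real) auto
    then show False using nle by (simp add: m_def d_def algebra_simps)
  qed
  \<comment> \<open>A bound \<open>of_real e \<sqsubseteq> m\<close> would lower the top of the
    spectrum of \<open>d\<close> below \<open>\<delta>\<close>.\<close>
  have m0: False if e: "e > 0" "of_real e \<sqsubseteq> m" for e
  proof -
    define e' where "e' = min e M"
    have "M > 0" using \<delta> by (simp add: \<delta>_def) (smt (verit) norm_ge_zero)
    then have e': "0 < e'" "e' \<le> e" "e' \<le> M" using e by (auto simp: e'_def)
    have "cstar_positive ((m - of_real e) + of_real (e - e'))" using e e' by (intro pos_add pos_of_real) auto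
    also have "(m - of_real e) + of_real (e - e') = of_real (M - e') - (d + of_real (norm d))"
      by (simp add: m_def \<delta>_def)
    finally have "norm (d + of_real (norm d)) \<le> M - e'"
      using pos_norm_bounds(2)[OF sad] e' by (subst pos_norm_le_iff) (simp_all add: add.commute)
    then show False using e' by (simp add: M_def)
  qed
  obtain \<eta> where \<eta>: "\<eta> > 0" "of_real \<eta> \<sqsubseteq> a" "of_real \<eta> \<sqsubseteq> b"
  proof -
    obtain r s where rs: "0 < r" "of_real r \<sqsubseteq> a" "0 < s" "of_real s \<sqsubseteq> b"
      using cone_bounded_below a b by metis
    have *: "(of_real (min r s) :: 'a) \<sqsubseteq> of_real r" "(of_real (min r s) :: 'a) \<sqsubseteq> of_real s"
      using pos_of_real[of "r - min r s", where ?'a = 'a] pos_of_real[of "s - min r s", where ?'a = 'a] by simp_all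
    show ?thesis using that[of "min r s"] cle_trans[OF *(1) rs(2)] cle_trans[OF *(2) rs(4)] rs by simp
  qed
  \<comment> \<open>The infimum is dual to maximising \<open>f a\<close> over states
    \<open>f\<close> with \<open>f m = 0\<close>; the multiple of \<open>m\<close> is the multiplier
    of that constraint. The lower bound \<open>\<eta>\<close> keeps \<open>\<alpha>\<close>
    positive.\<close>
  define A where "A = {t. \<exists>s\<ge>0. a \<sqsubseteq> of_real t + s *\<^sub>R m}"
  define \<alpha> where "\<alpha> = Inf A"
  have A\<eta>: "\<eta> \<le> t" if tA: "t \<in> A" for t
  proof (rule ccontr)
    assume t: "\<not> \<eta> \<le> t"
    obtain s where s: "s \<ge> 0" "a \<sqsubseteq> of_real t + s *\<^sub>R m" using tA unfolding A_def by blast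
    define e where "e = (\<eta> - t) / (s + 1)"
    have e: "e > 0" "e * (s + 1) = \<eta> - t" using t s by (simp_all add: e_def)
    have "cstar_positive ((of_real t + s *\<^sub>R m - a) + (a - of_real \<eta>) + m)"
      using s \<eta> m by (intro pos_add)
    also have "\<dots> = (s + 1) *\<^sub>R m - of_real (\<eta> - t)" by (simp add: algebra_simps)
    also have "\<dots> = (s + 1) *\<^sub>R (m - of_real e)"
      unfolding e(2)[symmetric] by (simp add: of_real_def algebra_simps)
    finally have "of_real e \<sqsubseteq> m" by (rule pos_scaleR_cancel) (use s in simp)
    then show False by (rule m0[OF e(1)])
  qed
  have "norm a \<in> A" unfolding A_def using pos_norm_bounds(1)[of a] a by (auto intro!: exI[of _ 0])
  then have Ane: "A \<noteq> {}" by blast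
  have Abdd: "bdd_below A" using A\<eta> by (rule bdd_belowI)
  have \<alpha>\<eta>: "\<eta> \<le> \<alpha>" unfolding \<alpha>_def using Ane A\<eta> by (rule cInf_greatest)
  have A_I: "K * \<alpha> \<le> x" if "K > 0" "s \<ge> 0" "K *\<^sub>R a \<sqsubseteq> of_real x + s *\<^sub>R m" for K x s
  proof -
    have "cstar_positive (inverse K *\<^sub>R (of_real x + s *\<^sub>R m - K *\<^sub>R a))" using that by (intro pos_scaleR) auto
    also have "inverse K *\<^sub>R (of_real x + s *\<^sub>R m - K *\<^sub>R a) = of_real (x / K) + (s / K) *\<^sub>R m - a"
      using that by (simp add: of_real_def algebra_simps divide_inverse)
    finally have "x / K \<in> A" unfolding A_def using that by (auto intro!: exI[of _ "s / K"] simp del: of_real_divide)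
    then have "\<alpha> \<le> x / K" unfolding \<alpha>_def using Abdd by (rule cInf_lower)
    then show ?thesis using that by (simp add: field_simps)
  qed
  \<comment> \<open>The second dual problem: maximise \<open>f b\<close> over states with
    \<open>f m = 0\<close> and \<open>f a = \<alpha>\<close>, the latter constraint having
    multiplier \<open>r\<close>.\<close>
  define B where "B = {t. \<exists>s\<ge>0. \<exists>r\<ge>0. b \<sqsubseteq> of_real t + s *\<^sub>R m + r *\<^sub>R (of_real \<alpha> - a)}"
  define \<beta> where "\<beta> = Inf B"
  have B\<eta>: "\<eta> \<le> t" if tB: "t \<in> B" for t
  proof (rule ccontr)
    assume t: "\<not> \<eta> \<le> t"
    obtain s r where s: "s \<ge> 0" "r \<ge> 0" "b \<sqsubseteq> of_real t + s *\<^sub>R m + r *\<^sub>R (of_real \<alpha> - a)"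
      using tB unfolding B_def by blast
    obtain u where u: "u \<in> A" "u < \<alpha> + (\<eta> - t)"
      using cInf_lessD[OF Ane, of "\<alpha> + (\<eta> - t)"] t by (auto simp: \<alpha>_def)
    obtain v where v: "v \<ge> 0" "a \<sqsubseteq> of_real u + v *\<^sub>R m" using u unfolding A_def by blast
    have "cstar_positive ((of_real t + s *\<^sub>R m + r *\<^sub>R (of_real \<alpha> - a) - b) + (b - of_real \<eta>) + (of_real u + v *\<^sub>R m - a))"
      using s \<eta> v by (intro pos_add)
    also have "(of_real t + s *\<^sub>R m + r *\<^sub>R (of_real \<alpha> - a) - b) + (b - of_real \<eta>) + (of_real u + v *\<^sub>R m - a)
      = of_real (r * \<alpha> + t - \<eta> + u) + (s + v) *\<^sub>R m - (r + 1) *\<^sub>R a"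
      by (simp add: of_real_def algebra_simps)
    finally have "(r + 1) * \<alpha> \<le> r * \<alpha> + t - \<eta> + u" using s v by (intro A_I[where s = "s + v"]) auto
    then show False using u by (simp add: algebra_simps)
  qed
  have "norm b \<in> B" unfolding B_def using pos_norm_bounds(1)[of b] b by (auto intro!: exI[of _ 0])
  then have Bne: "B \<noteq> {}" by blast
  have Bdd: "bdd_below B" using B\<eta> by (rule bdd_belowI)
  define C where "C = 1 + (\<alpha> + 1) / \<eta>"
  have C: "C > 0" using \<eta> \<alpha>\<eta> by (simp add: C_def add_pos_nonneg)
  obtain t2 where t2: "t2 \<in> B" "t2 < \<beta> + \<delta> / 4" using cInf_lessD[OF Bne, of "\<beta> + \<delta> / 4"] \<delta> by (auto simp: \<beta>_def)
  obtain s2 r where s2: "s2 \<ge> 0" "r \<ge> 0" "b \<sqsubseteq> of_real t2 + s2 *\<^sub>R m + r *\<^sub>R (of_real \<alpha> - a)"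
    using t2 unfolding B_def by blast
  \<comment> \<open>The near-minimiser \<open>t2\<close>, with its multiplier \<open>r\<close>, is
    fixed beforehand, because the error \<open>t1 - \<alpha>\<close> will be amplified by
    \<open>q * r\<close> with \<open>q \<le> C\<close>.\<close>
  define e where "e = min (min 1 (\<delta> / 4)) (\<delta> / (4 * (r + 1) * C))"
  have e: "e > 0" "e \<le> 1" "e \<le> \<delta> / 4" "e \<le> \<delta> / (4 * (r + 1) * C)"
    using \<delta> s2 C unfolding e_def by (simp, linarith+)
  obtain t1 where t1: "t1 \<in> A" "t1 < \<alpha> + e" using cInf_lessD[OF Ane, of "\<alpha> + e"] e by (auto simp: \<alpha>_def)
  obtain s1 where s1: "s1 \<ge> 0" "a \<sqsubseteq> of_real t1 + s1 *\<^sub>R m" using t1 unfolding A_def by blast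
  have t1\<alpha>: "\<alpha> \<le> t1" unfolding \<alpha>_def using t1 Abdd by (intro cInf_lower)
  have tp: "t1 > 0" "t2 > 0" "t2 \<ge> \<eta>" using \<eta> \<alpha>\<eta> t1\<alpha> B\<eta>[OF t2(1)] by auto
  define k where "k = s2 *\<^sub>R m + r *\<^sub>R (of_real t1 + s1 *\<^sub>R m - a)"
  have k: "cstar_positive k" unfolding k_def using s1 s2 m by (intro pos_add pos_scaleR)
  \<comment> \<open>To 1 are added penalties on which the extremal state nearly vanishes. They are
    scaled so that \<open>t1 *\<^sub>R y\<close> and \<open>t2 *\<^sub>R y\<close> contain the
    multipliers needed to dominate \<open>a\<close> and \<open>b\<close>.\<close>
  define y where "y = 1 + (s1 / t1) *\<^sub>R m + (1 / t2) *\<^sub>R k"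
  have y: "y \<in> pos_def_cone" unfolding y_def using k m s1 tp by (intro cone_add pos_scaleR) auto
  have ay: "a \<sqsubseteq> t1 *\<^sub>R y"
  proof -
    have "cstar_positive ((of_real t1 + s1 *\<^sub>R m - a) + (t1 / t2) *\<^sub>R k)"
      using k s1 tp by (intro pos_add pos_scaleR) auto
    also have "(of_real t1 + s1 *\<^sub>R m - a) + (t1 / t2) *\<^sub>R k = t1 *\<^sub>R y - a"
      using tp by (simp add: y_def of_real_def algebra_simps)
    finally show ?thesis .
  qed
  have bY: "b \<sqsubseteq> t2 *\<^sub>R y"
  proof -
    have "cstar_positive ((of_real t2 + s2 *\<^sub>R m + r *\<^sub>R (of_real \<alpha> - a) - b)
        + (of_real (r * (t1 - \<alpha>)) + ((r * s1) *\<^sub>R m + (t2 * s1 / t1) *\<^sub>R m)))"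
      using s2(3) by (rule pos_add) (use m s1 s2 tp t1\<alpha> in \<open>intro pos_add pos_scaleR pos_of_real; simp\<close>)
    also have "(of_real t2 + s2 *\<^sub>R m + r *\<^sub>R (of_real \<alpha> - a) - b)
        + (of_real (r * (t1 - \<alpha>)) + ((r * s1) *\<^sub>R m + (t2 * s1 / t1) *\<^sub>R m)) = t2 *\<^sub>R y - b"
      using tp by (simp add: y_def k_def of_real_def algebra_simps)
    finally show ?thesis .
  qed
  define q where "q = (t1 + t2) / t2"
  have q: "q \<ge> 0" "q \<le> C"
  proof -
    have "t1 / t2 \<le> (\<alpha> + 1) / \<eta>" using t1 e tp \<eta> \<alpha>\<eta> by (intro frac_le) auto
    moreover have "q = 1 + t1 / t2" using tp by (simp add: q_def add_divide_distrib)
    ultimately show "q \<ge> 0" "q \<le> C" using tp by (auto simp: C_def)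
  qed
  let ?S = "(t1 + t2) * s1 / t1 + q * s2 + q * r * s1 + 1"
  have "cstar_positive ((t1 + t2) *\<^sub>R y - c)" using gauge[OF y tp(1,2) ay bY] .
  also have "(t1 + t2) *\<^sub>R y - c = of_real (t1 + t2 - \<delta> - \<alpha> + q * r * (t1 - \<alpha>)) + ?S *\<^sub>R m
      + (q * r + 1) *\<^sub>R (of_real \<alpha> - a) - b"
  proof -
    \<comment> \<open>With this substitution the gauge inequality for \<open>c\<close> becomes a
      bound on \<open>b\<close> of the shape used in \<open>B\<close>, with a constant smaller than
      \<open>\<beta>\<close>.\<close>
    have c': "c = of_real \<delta> - m + a + b" by (simp add: m_def d_def)
    have "(t1 + t2) *\<^sub>R y = (t1 + t2) *\<^sub>R 1 + ((t1 + t2) * s1 / t1) *\<^sub>R m + q *\<^sub>R k"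
      by (simp add: y_def q_def scaleR_add_right)
    then show ?thesis unfolding c' by (simp add: k_def of_real_def algebra_simps)
  qed
  finally have *: "b \<sqsubseteq> of_real (t1 + t2 - \<delta> - \<alpha> + q * r * (t1 - \<alpha>)) + ?S *\<^sub>R m
      + (q * r + 1) *\<^sub>R (of_real \<alpha> - a)" .
  have "?S \<ge> 0" "q * r + 1 \<ge> 0" using q s1 s2 tp by simp_all
  with * have "t1 + t2 - \<delta> - \<alpha> + q * r * (t1 - \<alpha>) \<in> B" unfolding B_def by blast
  then have "\<beta> \<le> t1 + t2 - \<delta> - \<alpha> + q * r * (t1 - \<alpha>)" unfolding \<beta>_def using Bdd by (rule cInf_lower)
  moreover have "q * r * (t1 - \<alpha>) \<le> \<delta> / 4"
  proof -
    have "q * r * (t1 - \<alpha>) \<le> (C * (r + 1)) * (\<delta> / (4 * (r + 1) * C))"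
      using q s2 C t1 t1\<alpha> e by (intro mult_mono) auto
    also have "\<dots> = \<delta> / 4"
    proof -
      have "C * (r + 1) \<noteq> 0" using C s2 by simp
      moreover have "4 * (r + 1) * C = (C * (r + 1)) * 4" by simp
      ultimately show ?thesis by (metis nonzero_mult_div_cancel_left times_divide_eq_right mult_divide_mult_cancel_left)
    qed
    finally show ?thesis .
  qed
  ultimately show False using t1 t2 e \<delta> by simp
qed

lemma cone_square: "x \<in> pos_def_cone \<Longrightarrow> x * x \<in> pos_def_cone"
  by (intro coneI pos_square alg_invertible_mult) simp_all

lemma cone_add_cone: "x \<in> pos_def_cone \<Longrightarrow> y \<in> pos_def_cone \<Longrightarrow> x + y \<in> pos_def_cone"
  by (simp add: cone_add cone_pos)

text \<open>The separation lemma is used twice: in the target for \<open>\<psi> (x + y)\<close>,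
  with test elements pulled back by surjectivity, and in the source for the preimage
  \<open>z\<close> of \<open>\<psi> x + \<psi> y\<close>.\<close>

lemma gauge_additive:
  fixes \<psi> :: "'a::cstar_algebra \<Rightarrow> 'b::cstar_algebra"
  assumes onto: "\<psi> ` pos_def_cone = pos_def_cone"
    and gauge: "\<And>x y r. \<lbrakk>x \<in> pos_def_cone; y \<in> pos_def_cone; 0 < r\<rbrakk> \<Longrightarrow> x \<sqsubseteq> r *\<^sub>R y \<longleftrightarrow> \<psi> x \<sqsubseteq> r *\<^sub>R \<psi> y"
    and x: "x \<in> pos_def_cone" and y: "y \<in> pos_def_cone"
  shows "\<psi> (x + y) = \<psi> x + \<psi> y"
proof (rule cle_antisym)
  have im: "\<psi> z \<in> pos_def_cone" if "z \<in> pos_def_cone" for z using onto that by blast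
  have xy: "x + y \<in> pos_def_cone" using x y by (rule cone_add_cone)
  show "\<psi> (x + y) \<sqsubseteq> \<psi> x + \<psi> y"
  proof (rule gauge_separation)
    fix w s t assume w: "w \<in> pos_def_cone" and st: "0 < s" "0 < t" and le: "\<psi> x \<sqsubseteq> s *\<^sub>R w" "\<psi> y \<sqsubseteq> t *\<^sub>R w"
    from w onto obtain v where v: "v \<in> pos_def_cone" "w = \<psi> v" by blast
    have "x \<sqsubseteq> s *\<^sub>R v" "y \<sqsubseteq> t *\<^sub>R v" using gauge v x y st le by blast+
    then have "cstar_positive ((s *\<^sub>R v - x) + (t *\<^sub>R v - y))" by (rule pos_add)
    then have "x + y \<sqsubseteq> (s + t) *\<^sub>R v" by (simp add: algebra_simps)
    then show "\<psi> (x + y) \<sqsubseteq> (s + t) *\<^sub>R w" using gauge[OF xy v(1), of "s + t"] st v by simp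
  qed (use im x y xy in simp_all)
  have "\<psi> x + \<psi> y \<in> pos_def_cone" using im x y by (simp add: cone_add_cone)
  with onto obtain z where z: "z \<in> pos_def_cone" "\<psi> z = \<psi> x + \<psi> y" by (metis imageE)
  have "z \<sqsubseteq> x + y"
  proof (rule gauge_separation)
    fix w s t assume w: "w \<in> pos_def_cone" and st: "0 < s" "0 < t" and le: "x \<sqsubseteq> s *\<^sub>R w" "y \<sqsubseteq> t *\<^sub>R w"
    have "\<psi> x \<sqsubseteq> s *\<^sub>R \<psi> w" "\<psi> y \<sqsubseteq> t *\<^sub>R \<psi> w" using gauge w x y st le by blast+
    then have "cstar_positive ((s *\<^sub>R \<psi> w - \<psi> x) + (t *\<^sub>R \<psi> w - \<psi> y))" by (rule pos_add)
    then have "\<psi> z \<sqsubseteq> (s + t) *\<^sub>R \<psi> w" unfolding z by (simp add: algebra_simps)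
    then show "z \<sqsubseteq> (s + t) *\<^sub>R w" using gauge[OF z(1) w, of "s + t"] st by simp
  qed (use x y z in simp_all)
  then show "\<psi> x + \<psi> y \<sqsubseteq> \<psi> (x + y)" using gauge[OF z(1) xy, of 1] z by simp
qed

lemma gauge_homogeneous:
  fixes \<psi> :: "'a::cstar_algebra \<Rightarrow> 'b::cstar_algebra"
  assumes gauge: "\<And>x y r. \<lbrakk>x \<in> pos_def_cone; y \<in> pos_def_cone; 0 < r\<rbrakk> \<Longrightarrow> x \<sqsubseteq> r *\<^sub>R y \<longleftrightarrow> \<psi> x \<sqsubseteq> r *\<^sub>R \<psi> y"
    and x: "x \<in> pos_def_cone" and r: "0 < r"
  shows "\<psi> (r *\<^sub>R x) = r *\<^sub>R \<psi> x"
proof (rule cle_antisym)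
  have rx: "r *\<^sub>R x \<in> pos_def_cone" using x r by (rule cone_scaleR)
  show "\<psi> (r *\<^sub>R x) \<sqsubseteq> r *\<^sub>R \<psi> x" using gauge[OF rx x r] by simp
  have "\<psi> x \<sqsubseteq> inverse r *\<^sub>R \<psi> (r *\<^sub>R x)" using gauge[OF x rx, of "inverse r"] r by simp
  then have "cstar_positive (r *\<^sub>R (inverse r *\<^sub>R \<psi> (r *\<^sub>R x) - \<psi> x))" using r by (intro pos_scaleR) auto
  then show "r *\<^sub>R \<psi> x \<sqsubseteq> \<psi> (r *\<^sub>R x)" using r by (simp add: scaleR_diff_right)
qed

section \<open>Real and imaginary parts, linear extension from the cone\<close>

definition re_part :: "'a::cstar_algebra \<Rightarrow> 'a" where
  "re_part a = (1 / 2) *\<^sub>R (a + cstar_adj a)"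

definition im_part :: "'a::cstar_algebra \<Rightarrow> 'a" where
  "im_part a = (1 / 2) *\<^sub>R (- \<i> *\<^sub>C (a - cstar_adj a))"

lemma scaleC_zero_right [simp]: "c *\<^sub>C 0 = (0::'a::cstar_algebra)"
  using scaleC_add_right[of c 0 0] by simp

lemma re_part_self_adjoint [simp]: "self_adjoint (re_part a)"
  by (simp add: re_part_def add.commute)

lemma im_part_self_adjoint [simp]: "self_adjoint (im_part a)"
  by (simp add: im_part_def cstar_adj_scaleC scaleC_diff_right scaleC_minus_left)

lemma re_im_part: "a = re_part a + \<i> *\<^sub>C im_part a"
proof -
  have "\<i> *\<^sub>C im_part a = (1 / 2) *\<^sub>R (a - cstar_adj a)"
    unfolding im_part_def scaleC_scaleR scaleC_scaleC by simp
  then show ?thesis by (simp add: re_part_def scaleR_add_right scaleR_diff_right flip: scaleR_add_left)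
qed

lemma re_part_add: "re_part (a + b) = re_part a + re_part b"
  and im_part_add: "im_part (a + b) = im_part a + im_part b"
  by (simp_all add: re_part_def im_part_def scaleR_add_right scaleC_add_right scaleC_diff_right algebra_simps)

lemma re_part_adj: "re_part (cstar_adj a) = re_part a"
  and im_part_adj: "im_part (cstar_adj a) = - im_part a"
  by (simp_all add: re_part_def im_part_def scaleC_diff_right algebra_simps)

lemma re_part_of_self_adjoint: "self_adjoint a \<Longrightarrow> re_part a = a"
  and im_part_of_self_adjoint: "self_adjoint a \<Longrightarrow> im_part a = 0"
  by (simp_all add: re_part_def im_part_def flip: scaleR_2)

lemma re_part_scaleR: "re_part (r *\<^sub>R a) = r *\<^sub>R re_part a"
  and im_part_scaleR: "im_part (r *\<^sub>R a) = r *\<^sub>R im_part a"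
  by (simp_all add: re_part_def im_part_def scaleC_scaleR scaleC_diff_right scaleR_add_right scaleR_diff_right)

lemma re_part_ii: "re_part (\<i> *\<^sub>C a) = - im_part a"
  and im_part_ii: "im_part (\<i> *\<^sub>C a) = re_part a"
  by (simp_all add: re_part_def im_part_def cstar_adj_scaleC scaleC_diff_right scaleC_add_right
      scaleC_scaleC scaleC_minus_left algebra_simps)

lemma scaleC_Re_Im: "c *\<^sub>C a = Re c *\<^sub>R a + Im c *\<^sub>R (\<i> *\<^sub>C (a::'a::cstar_algebra))"
proof -
  have "complex_of_real (Re c) + complex_of_real (Im c) * \<i> = c" by (simp add: complex_eq_iff)
  then have "c *\<^sub>C a = (complex_of_real (Re c) + complex_of_real (Im c) * \<i>) *\<^sub>C a" by simp
  then show ?thesis by (simp only: scaleC_add_left scaleC_of_real flip: scaleC_scaleC)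
qed

text \<open>A self-adjoint \<open>x\<close> is the difference \<open>(x + n x) - n x\<close> of cone
  elements, which defines a real-linear \<open>R\<close>; real and imaginary parts then complexify
  it to \<open>T\<close>.\<close>

lemma cone_linear_extension:
  fixes \<psi> :: "'a::cstar_algebra \<Rightarrow> 'b::cstar_algebra"
  assumes add: "\<And>x y. \<lbrakk>x \<in> pos_def_cone; y \<in> pos_def_cone\<rbrakk> \<Longrightarrow> \<psi> (x + y) = \<psi> x + \<psi> y"
    and hom: "\<And>x r. \<lbrakk>x \<in> pos_def_cone; 0 < r\<rbrakk> \<Longrightarrow> \<psi> (r *\<^sub>R x) = r *\<^sub>R \<psi> x"
    and sa: "\<And>x. x \<in> pos_def_cone \<Longrightarrow> self_adjoint (\<psi> x)"
  obtains T where "\<And>x y. T (x + y) = T x + T y" "\<And>c x. T (c *\<^sub>C x) = c *\<^sub>C T x"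
    "\<And>x. T (cstar_adj x) = cstar_adj (T x)" "\<And>x. x \<in> pos_def_cone \<Longrightarrow> T x = \<psi> x"
proof -
  define n where "n x = (of_real (norm x + 1) :: 'a)" for x :: 'a
  define R where "R x = \<psi> (x + n x) - \<psi> (n x)" for x
  have n: "n x \<in> pos_def_cone" for x unfolding n_def by (rule cone_of_real) (simp add: add_nonneg_pos)
  have xn: "x + n x \<in> pos_def_cone" if "self_adjoint x" for x
    unfolding n_def by (rule cone_add_of_real) (use that in simp_all)
  \<comment> \<open>Independence of the shift: any cone element \<open>p\<close> with
    \<open>x + p\<close> in the cone may replace \<open>n x\<close>. Linearity follows by choosing
    shifts that fit.\<close>
  have R: "R x = \<psi> (x + p) - \<psi> p" if x: "self_adjoint x" "p \<in> pos_def_cone" "x + p \<in> pos_def_cone" for x p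
  proof -
    have "\<psi> (x + n x) + \<psi> p = \<psi> ((x + n x) + p)" using x xn by (intro add[symmetric])
    also have "(x + n x) + p = (x + p) + n x" by (simp add: algebra_simps)
    also have "\<psi> \<dots> = \<psi> (x + p) + \<psi> (n x)" using x n by (intro add)
    finally show ?thesis by (simp add: R_def algebra_simps)
  qed
  have Radd: "R (x + y) = R x + R y" if "self_adjoint x" "self_adjoint y" for x y
  proof -
    have e: "x + y + (n x + n y) = (x + n x) + (y + n y)" by (simp add: algebra_simps)
    have "R (x + y) = \<psi> (x + y + (n x + n y)) - \<psi> (n x + n y)"
      using that n xn by (intro R) (simp_all add: e cone_add_cone)
    then show ?thesis unfolding e using that n xn by (simp add: add R_def)
  qed
  have R0: "R 0 = 0" using Radd[of 0 0] by simp
  have Rminus: "R (- x) = - R x" if "self_adjoint x" for x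
    using Radd[of x "- x"] that R0 by (simp add: eq_neg_iff_add_eq_0 add.commute)
  have Rpos: "R (r *\<^sub>R x) = r *\<^sub>R R x" if "self_adjoint x" "r > 0" for r x
  proof -
    have e: "r *\<^sub>R x + r *\<^sub>R n x = r *\<^sub>R (x + n x)" by (simp add: scaleR_add_right)
    have "R (r *\<^sub>R x) = \<psi> (r *\<^sub>R x + r *\<^sub>R n x) - \<psi> (r *\<^sub>R n x)"
      using that n xn by (intro R) (simp_all add: e cone_scaleR)
    then show ?thesis unfolding e using that n xn by (simp add: hom R_def scaleR_diff_right)
  qed
  have Rscale: "R (r *\<^sub>R x) = r *\<^sub>R R x" if x: "self_adjoint x" for r x
  proof (cases r "0::real" rule: linorder_cases)
    case less
    then show ?thesis using Rpos[OF x, of "- r"] Rminus[of "r *\<^sub>R x"] x by simp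
  qed (use x R0 Rpos in auto)
  have Rsa: "self_adjoint (R x)" if "self_adjoint x" for x using that n xn sa by (simp add: R_def)
  have Rcone: "R x = \<psi> x" if "x \<in> pos_def_cone" for x
    using R[of x x] that by (simp add: add cone_add_cone)
  define T where "T a = R (re_part a) + \<i> *\<^sub>C R (im_part a)" for a
  have Tadd: "T (a + b) = T a + T b" for a b
    by (simp add: T_def re_part_add im_part_add Radd scaleC_add_right algebra_simps)
  have Tscale: "T (r *\<^sub>R a) = r *\<^sub>R T a" for r a
    by (simp add: T_def re_part_scaleR im_part_scaleR Rscale scaleC_scaleR scaleR_add_right)
  have Tii: "T (\<i> *\<^sub>C a) = \<i> *\<^sub>C T a" for a
    by (simp add: T_def re_part_ii im_part_ii Rminus scaleC_add_right scaleC_scaleC scaleC_minus_left algebra_simps)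
  show ?thesis
  proof (rule that[of T])
    show "T (a + b) = T a + T b" for a b by (rule Tadd)
    show "T (c *\<^sub>C a) = c *\<^sub>C T a" for c a
      unfolding scaleC_Re_Im[of c] by (simp add: Tadd Tscale Tii)
    show "T (cstar_adj a) = cstar_adj (T a)" for a
      by (simp add: T_def re_part_adj im_part_adj Rminus Rsa cstar_adj_scaleC scaleC_minus_left scaleC_minus_right)
    show "T x = \<psi> x" if "x \<in> pos_def_cone" for x
      using that Rcone R0 by (simp add: T_def re_part_of_self_adjoint im_part_of_self_adjoint)
  qed
qed

lemma cone_spans:
  fixes T S :: "'a::cstar_algebra \<Rightarrow> 'b::cstar_algebra"
  assumes T: "\<And>x y. T (x + y) = T x + T y" "\<And>c x. T (c *\<^sub>C x) = c *\<^sub>C T x"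
    and S: "\<And>x y. S (x + y) = S x + S y" "\<And>c x. S (c *\<^sub>C x) = c *\<^sub>C S x"
    and eq: "\<And>x. x \<in> pos_def_cone \<Longrightarrow> T x = S x"
  shows "T a = S a"
proof -
  have *: "T x = S x" if "self_adjoint x" for x
  proof -
    define n where "n = (of_real (norm x + 1) :: 'a)"
    have "T (x + n) = S (x + n)" "T n = S n"
      using that unfolding n_def by (intro eq cone_add_of_real cone_of_real; simp add: add_nonneg_pos)+
    then show ?thesis by (simp add: T S)
  qed
  have "T (re_part a + \<i> *\<^sub>C im_part a) = S (re_part a + \<i> *\<^sub>C im_part a)" by (simp add: T S *)
  then show ?thesis by (simp flip: re_im_part)
qed

section \<open>Kadison's theorem on unital order isomorphisms\<close>

text \<open>\<open>K u v w\<close> says that the matrix with rows \<open>(T w, T v)\<close>, \<open>(T v, T u)\<close> is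
  positive on the vectors \<open>(1, - m)\<close>. The induction expands \<open>1 = ((1 - a) + a) ^ n\<close>: the Bernstein terms
  \<open>h\<^sub>k = (n choose k) a ^ k (1 - a) ^ (n - k)\<close> satisfy \<open>K h\<^sub>k (k h\<^sub>k) (k\<^sup>2 h\<^sub>k)\<close>, and
  \<open>\<Sum>k. k\<^sup>2 h\<^sub>k = n\<^sup>2 a\<^sup>2 + n (a - a\<^sup>2)\<close>.\<close>

lemma kadison_inequality_unit_interval:
  fixes T :: "'a::cstar_algebra \<Rightarrow> 'b::cstar_algebra"
  assumes add: "\<And>x y. T (x + y) = T x + T y" and scale: "\<And>r x. T (r *\<^sub>R x) = r *\<^sub>R T x"
    and adj: "\<And>x. T (cstar_adj x) = cstar_adj (T x)"
    and pos: "\<And>x. cstar_positive x \<Longrightarrow> cstar_positive (T x)" and unital: "T 1 = 1"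
    and a: "cstar_positive a" "a \<sqsubseteq> 1"
  shows "T a * T a \<sqsubseteq> T (a * a)"
proof -
  define K where "K u v w \<longleftrightarrow> (\<forall>m. self_adjoint m \<longrightarrow> cstar_positive (T w - m * T v - T v * m + m * T u * m))" for u v w
  have Kadd: "K (u + u') (v + v') (w + w')" if A: "K u v w" "K u' v' w'" for u v w u' v' w'
    unfolding K_def
  proof (intro allI impI)
    fix m :: 'b assume m: "self_adjoint m"
    have "cstar_positive (T w - m * T v - T v * m + m * T u * m)"
      "cstar_positive (T w' - m * T v' - T v' * m + m * T u' * m)"
      using A m unfolding K_def by blast+
    then have "cstar_positive ((T w - m * T v - T v * m + m * T u * m) + (T w' - m * T v' - T v' * m + m * T u' * m))"
      by (rule pos_add)
    also have "(T w - m * T v - T v * m + m * T u * m) + (T w' - m * T v' - T v' * m + m * T u' * m)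
      = T (w + w') - m * T (v + v') - T (v + v') * m + m * T (u + u') * m"
      by (simp add: add algebra_simps)
    finally show "cstar_positive (T (w + w') - m * T (v + v') - T (v + v') * m + m * T (u + u') * m)" .
  qed
  \<comment> \<open>Substituting \<open>m - 1\<close> for \<open>m\<close> raises the index by one:
    a triple \<open>h\<close>, \<open>k h\<close>, \<open>k^2 h\<close> becomes \<open>h\<close>,
    \<open>(k + 1) h\<close>, \<open>(k + 1)^2 h\<close>.\<close>
  have Kshift: "K u (v + u) (w + 2 *\<^sub>R v + u)" if A: "K u v w" for u v w
    unfolding K_def
  proof (intro allI impI)
    fix m :: 'b assume "self_adjoint m"
    then have "self_adjoint (m - 1)" by simp
    then have "cstar_positive (T w - (m - 1) * T v - T v * (m - 1) + (m - 1) * T u * (m - 1))"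
      using A unfolding K_def by blast
    also have "T w - (m - 1) * T v - T v * (m - 1) + (m - 1) * T u * (m - 1)
      = T (w + 2 *\<^sub>R v + u) - m * T (v + u) - T (v + u) * m + m * T u * m"
      by (simp add: add scale algebra_simps scaleR_2)
    finally show "cstar_positive (T (w + 2 *\<^sub>R v + u) - m * T (v + u) - T (v + u) * m + m * T u * m)" .
  qed
  have a1: "cstar_positive (1 - a)" using a by simp
  \<comment> \<open>With \<open>a\<close> as success probability, \<open>real n *\<^sub>R a\<close>
    and \<open>W n\<close> are the first and second moments of the binomial distribution.\<close>
  define W where "W n = (real n)\<^sup>2 *\<^sub>R (a * a) + real n *\<^sub>R (a - a * a)" for n
  have main: "K h (real n *\<^sub>R (a * h)) (W n * h)" if "cstar_positive h" "h * a = a * h" for n h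
    using that
  proof (induction n arbitrary: h)
    case 0
    have "T 0 = 0" using scale[of 0 0] by simp
    then show ?case using 0 pos by (simp add: K_def W_def pos_conj)
  next
    case (Suc n)
    note comm = Suc.prems(2)
    have comm': "h * (a * z) = a * (h * z)" for z using comm by (metis mult.assoc)
    \<comment> \<open>One trial is split off: failure \<open>h * (1 - a)\<close> keeps the index,
      success \<open>h * a\<close> shifts it.\<close>
    let ?h1 = "h * (1 - a)" and ?h2 = "h * a"
    have p: "cstar_positive ?h1" "cstar_positive ?h2"
      using Suc.prems a(1) a1 by (intro pos_mult_commuting; simp add: right_diff_distrib left_diff_distrib)+
    have c: "?h1 * a = a * ?h1" "?h2 * a = a * ?h2" by (simp_all add: algebra_simps comm comm')
    have "K ?h1 (real n *\<^sub>R (a * ?h1)) (W n * ?h1)" "K ?h2 (real n *\<^sub>R (a * ?h2)) (W n * ?h2)"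
      using Suc.IH p c by blast+
    from Kadd[OF this(1) Kshift[OF this(2)]]
    have "K (?h1 + ?h2) (real n *\<^sub>R (a * ?h1) + (real n *\<^sub>R (a * ?h2) + ?h2))
      (W n * ?h1 + (W n * ?h2 + 2 *\<^sub>R (real n *\<^sub>R (a * ?h2)) + ?h2))" .
    moreover have "?h1 + ?h2 = h" by (simp add: algebra_simps)
    moreover have "real n *\<^sub>R (a * ?h1) + (real n *\<^sub>R (a * ?h2) + ?h2) = real (Suc n) *\<^sub>R (a * h)"
      by (simp add: algebra_simps comm)
    moreover have "W n * ?h1 + (W n * ?h2 + 2 *\<^sub>R (real n *\<^sub>R (a * ?h2)) + ?h2) = W (Suc n) * h"
      by (simp add: W_def algebra_simps comm comm' power2_eq_square)
    ultimately show ?case by metis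
  qed
  define X where "X = T (a * a) - T a * T a"
  define Y where "Y = T (a - a * a)"
  have saa: "self_adjoint a" using a(1) by (rule pos_self_adjoint)
  have saT: "self_adjoint (T x)" if "self_adjoint x" for x using that adj[of x] by simp
  have saY: "self_adjoint Y" unfolding Y_def using saa by (intro saT) (simp add: cstar_adj_mult)
  have XY: "cstar_positive (X + (1 / real n) *\<^sub>R Y)" if n: "n > 0" for n
  proof -
    \<comment> \<open>The mean itself is the optimal \<open>m\<close>. After division by
      \<open>n^2\<close> only \<open>Y / n\<close> separates the inequality from the claim, and it
      disappears as \<open>n\<close> grows.\<close>
    let ?m = "real n *\<^sub>R T a"
    have K1: "K 1 (real n *\<^sub>R (a * 1)) (W n * 1)" by (rule main) simp_all
    have m: "self_adjoint ?m" using saT[OF saa] by simp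
    have "cstar_positive (T (W n) - ?m * T (real n *\<^sub>R a) - T (real n *\<^sub>R a) * ?m + ?m * ?m)"
      using K1[unfolded K_def, rule_format, OF m] by (simp only: unital mult_1_right)
    also have "T (W n) - ?m * T (real n *\<^sub>R a) - T (real n *\<^sub>R a) * ?m + ?m * ?m
       = (real n)\<^sup>2 *\<^sub>R (X + (1 / real n) *\<^sub>R Y)"
    proof -
      have "T (W n) = (real n)\<^sup>2 *\<^sub>R T (a * a) + real n *\<^sub>R Y" by (simp only: W_def add scale Y_def)
      then show ?thesis using n by (simp add: X_def scale algebra_simps power2_eq_square)
    qed
    finally show ?thesis by (rule pos_scaleR_cancel) (use n in simp)
  qed
  have "cstar_positive X"
  proof (rule pos_archimedean)
    fix e :: real assume e: "e > 0"
    obtain n where n: "real n > norm Y / e" using reals_Archimedean2 by blast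
    moreover have "norm Y / e \<ge> 0" using e by simp
    ultimately have n0: "n > 0" by (metis not_gr0 of_nat_0 not_le)
    have "norm ((1 / real n) *\<^sub>R Y) \<le> e" using n n0 e by (simp add: field_simps)
    then have "cstar_positive (of_real e - (1 / real n) *\<^sub>R Y)" using saY by (intro norm_le_imp_pos) auto
    from pos_add[OF XY[OF n0] this] show "cstar_positive (X + of_real e)" by simp
  qed
  then show ?thesis by (simp add: X_def)
qed

lemma unital_order_iso_jordan:
  fixes T :: "'a::cstar_algebra \<Rightarrow> 'b::cstar_algebra" and S :: "'b \<Rightarrow> 'a"
  assumes T: "\<And>x y. T (x + y) = T x + T y" "\<And>c x. T (c *\<^sub>C x) = c *\<^sub>C T x"
      "\<And>x. T (cstar_adj x) = cstar_adj (T x)" "\<And>x. cstar_positive x \<Longrightarrow> cstar_positive (T x)" "T 1 = 1"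
    and S: "\<And>x y. S (x + y) = S x + S y" "\<And>c x. S (c *\<^sub>C x) = c *\<^sub>C S x"
      "\<And>x. S (cstar_adj x) = cstar_adj (S x)" "\<And>x. cstar_positive x \<Longrightarrow> cstar_positive (S x)" "S 1 = 1"
    and inv: "\<And>x. S (T x) = x" "\<And>x. T (S x) = x"
  shows "jordan_star_iso T"
proof -
  have Tr: "T (r *\<^sub>R x) = r *\<^sub>R T x" for r x using T(2)[of "complex_of_real r" x] by (simp add: scaleC_of_real)
  have Sr: "S (r *\<^sub>R x) = r *\<^sub>R S x" for r x using S(2)[of "complex_of_real r" x] by (simp add: scaleC_of_real)
  have Tm: "T (- x) = - T x" for x using Tr[of "-1" x] by simp
  have Td: "T (x - y) = T x - T y" for x y using T(1)[of x "- y"] Tm by simp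
  have unit: "T (a * a) = T a * T a" if a: "cstar_positive a" "a \<sqsubseteq> 1" for a
  proof (rule cle_antisym)
    show "T a * T a \<sqsubseteq> T (a * a)" using T Tr a by (intro kadison_inequality_unit_interval) auto
    have b: "cstar_positive (T a)" "T a \<sqsubseteq> 1" using a T(4)[OF a(2)] T by (auto simp: Td)
    have "S (T a) * S (T a) \<sqsubseteq> S (T a * T a)" using S Sr b by (intro kadison_inequality_unit_interval) auto
    from T(4)[OF this] show "T (a * a) \<sqsubseteq> T a * T a" by (simp add: Td inv)
  qed
  have sq_sa: "T (x * x) = T x * T x" if x: "self_adjoint x" for x
  proof -
    define N where "N = norm x + 1"
    have N: "N > 0" "norm x \<le> N" by (simp_all add: N_def add_nonneg_pos)
    \<comment> \<open>An affine change of variable moves \<open>x\<close> into the unit interval;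
      since \<open>T\<close> is linear and unital, preservation of the square carries back.\<close>
    define a where "a = (1 / (2 * N)) *\<^sub>R (of_real N + x)"
    have "cstar_positive a" unfolding a_def using x N by (intro pos_scaleR norm_le_imp_pos) auto
    moreover have "a \<sqsubseteq> 1"
    proof -
      have "cstar_positive ((1 / (2 * N)) *\<^sub>R (of_real N - x))" using x N by (intro pos_scaleR norm_le_imp_pos) auto
      also have "(1 / (2 * N)) *\<^sub>R (of_real N - x) = (1 / (2 * N) * (2 * N)) *\<^sub>R 1 - a"
        by (simp add: a_def of_real_def algebra_simps flip: scaleR_add_left)
      finally show ?thesis using N by simp
    qed
    ultimately have u: "T (a * a) = T a * T a" by (rule unit)
    have xa: "x = (2 * N) *\<^sub>R a - N *\<^sub>R 1" using N by (simp add: a_def of_real_def)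
    show ?thesis unfolding xa by (simp add: Td Tr T u algebra_simps)
  qed
  \<comment> \<open>Polarisation, conditional on the three squares involved, so that it serves
    self-adjoint elements now and arbitrary ones at the end.\<close>
  have sum2: "T (x * y + y * x) = T x * T y + T y * T x" if "\<And>z. z \<in> {x, y, x + y} \<Longrightarrow> T (z * z) = T z * T z" for x y
  proof -
    have eqs: "T (x * x) = T x * T x" "T (y * y) = T y * T y" "T ((x + y) * (x + y)) = T (x + y) * T (x + y)"
      by (rule that; simp)+
    have "x * y + y * x = (x + y) * (x + y) - x * x - y * y" by (simp add: algebra_simps)
    then have "T (x * y + y * x) = T (x + y) * T (x + y) - T x * T x - T y * T y" by (simp only: Td eqs)
    then show ?thesis by (simp add: T(1) algebra_simps)
  qed
  have sq: "T (a * a) = T a * T a" for a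
  proof -
    let ?x = "re_part a" and ?y = "im_part a"
    have e: "(u + \<i> *\<^sub>C v) * (u + \<i> *\<^sub>C v) = u * u - v * v + \<i> *\<^sub>C (u * v + v * u)" for u v :: "'c::cstar_algebra"
      by (simp add: algebra_simps mult_scaleC_left mult_scaleC_right scaleC_scaleC scaleC_add_right scaleC_minus_left)
    have "T (?x * ?y + ?y * ?x) = T ?x * T ?y + T ?y * T ?x"
      by (rule sum2) (auto intro!: sq_sa)
    then have "T ((?x + \<i> *\<^sub>C ?y) * (?x + \<i> *\<^sub>C ?y)) = T (?x + \<i> *\<^sub>C ?y) * T (?x + \<i> *\<^sub>C ?y)"
      unfolding e T(1,2) Td by (simp add: sq_sa)
    then show ?thesis by (simp flip: re_im_part)
  qed
  have "T (jordan_prod x y) = jordan_prod (T x) (T y)" for x y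
    unfolding jordan_prod_def Tr using sum2[OF sq] by simp
  moreover have "bij T" by (rule o_bij[of S]) (auto simp: inv)
  ultimately show ?thesis using T unfolding jordan_star_iso_def by blast
qed

lemma cone_gauge_iso_extends:
  fixes f :: "'a::cstar_algebra \<Rightarrow> 'b::cstar_algebra"
  assumes f: "f ` pos_def_cone = pos_def_cone" "f 1 = 1"
    and g: "\<And>x y r. \<lbrakk>x \<in> pos_def_cone; y \<in> pos_def_cone; 0 < r\<rbrakk> \<Longrightarrow> x \<sqsubseteq> r *\<^sub>R y \<longleftrightarrow> f x \<sqsubseteq> r *\<^sub>R f y"
  obtains T where "\<And>x y. T (x + y) = T x + T y" "\<And>c x. T (c *\<^sub>C x) = c *\<^sub>C T x"
    "\<And>x. T (cstar_adj x) = cstar_adj (T x)" "\<And>x. x \<in> pos_def_cone \<Longrightarrow> T x = f x"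
    "\<And>x. cstar_positive x \<Longrightarrow> cstar_positive (T x)" "T 1 = 1"
proof -
  have im: "f x \<in> pos_def_cone" if "x \<in> pos_def_cone" for x using f that by blast
  obtain T where T: "\<And>x y. T (x + y) = T x + T y" "\<And>c x. T (c *\<^sub>C x) = c *\<^sub>C T x"
    "\<And>x. T (cstar_adj x) = cstar_adj (T x)" "\<And>x. x \<in> pos_def_cone \<Longrightarrow> T x = f x"
  proof -
    show ?thesis
      by (rule cone_linear_extension[of f, OF gauge_additive[of f, OF f(1) g] gauge_homogeneous[of f, OF g]
            cone_self_adjoint[OF im]]; (assumption | (rule that; assumption)))
  qed
  have T1: "T 1 = 1" using T(4)[of 1] f by simp
  have "cstar_positive (T x)" if x: "cstar_positive x" for x
  proof (rule pos_archimedean)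
    fix e :: real assume "e > 0"
    then have "of_real e + x \<in> pos_def_cone" using x by (simp add: cone_add)
    then have "T (of_real e + x) \<in> pos_def_cone" using T(4) im by simp
    moreover have "T (of_real e) = of_real e"
      using T(2)[of "complex_of_real e" 1] by (simp only: T1 scaleC_of_real_one)
    ultimately show "cstar_positive (T x + of_real e)" by (simp add: T(1) cone_pos add.commute)
  qed
  then show ?thesis using that T T1 by blast
qed

text \<open>The gauge relation with \<open>r = 1\<close> makes \<open>\<xi>\<close> injective, and
  its inverse satisfies the same hypotheses. The two positive extensions are mutually inverse
  because the cone spans the algebra.\<close>

lemma cone_gauge_iso_extends_to_jordan:
  fixes \<xi> :: "'a::cstar_algebra \<Rightarrow> 'b::cstar_algebra"
  assumes onto: "\<xi> ` pos_def_cone = pos_def_cone"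
    and gauge: "\<And>x y r. \<lbrakk>x \<in> pos_def_cone; y \<in> pos_def_cone; 0 < r\<rbrakk> \<Longrightarrow> x \<sqsubseteq> r *\<^sub>R y \<longleftrightarrow> \<xi> x \<sqsubseteq> r *\<^sub>R \<xi> y"
    and unital: "\<xi> 1 = 1"
  obtains J where "jordan_star_iso J" "\<And>x. x \<in> pos_def_cone \<Longrightarrow> J x = \<xi> x"
proof -
  obtain T where T: "\<And>x y. T (x + y) = T x + T y" "\<And>c x. T (c *\<^sub>C x) = c *\<^sub>C T x"
    "\<And>x. T (cstar_adj x) = cstar_adj (T x)" "\<And>x. x \<in> pos_def_cone \<Longrightarrow> T x = \<xi> x"
    "\<And>x. cstar_positive x \<Longrightarrow> cstar_positive (T x)" "T 1 = 1"
  proof -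
    show ?thesis by (rule cone_gauge_iso_extends[of \<xi>, OF onto unital gauge]; (assumption | (rule that; assumption)))
  qed
  have inj: "inj_on \<xi> pos_def_cone"
  proof (rule inj_onI)
    fix x y assume xy: "x \<in> pos_def_cone" "y \<in> pos_def_cone" "\<xi> x = \<xi> y"
    then have "x \<sqsubseteq> 1 *\<^sub>R y" "y \<sqsubseteq> 1 *\<^sub>R x" by (simp_all only: gauge zero_less_one) simp_all
    then show "x = y" by (intro cle_antisym) simp_all
  qed
  define \<xi>' where "\<xi>' = inv_into pos_def_cone \<xi>"
  have l: "\<xi>' (\<xi> x) = x" if "x \<in> pos_def_cone" for x using inj that by (simp add: \<xi>'_def)
  have r: "\<xi> (\<xi>' y) = y" "\<xi>' y \<in> pos_def_cone" if "y \<in> pos_def_cone" for y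
    using that onto f_inv_into_f[of y \<xi> pos_def_cone] inv_into_into[of y \<xi> pos_def_cone]
    by (simp_all add: \<xi>'_def)
  have im: "\<xi> x \<in> pos_def_cone" if "x \<in> pos_def_cone" for x using onto that by blast
  have "\<xi>' ` pos_def_cone = pos_def_cone"
  proof
    show "\<xi>' ` pos_def_cone \<subseteq> pos_def_cone" using r by blast
    show "pos_def_cone \<subseteq> \<xi>' ` pos_def_cone" using l im by (metis imageI subsetI)
  qed
  moreover have "\<xi>' 1 = 1" using l[of 1] unital by simp
  moreover have "x \<sqsubseteq> s *\<^sub>R y \<longleftrightarrow> \<xi>' x \<sqsubseteq> s *\<^sub>R \<xi>' y"
    if "x \<in> pos_def_cone" "y \<in> pos_def_cone" "0 < s" for x y s
    using gauge[of "\<xi>' x" "\<xi>' y" s] r that by simp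
  note \<xi>' = calculation this
  obtain S where S: "\<And>x y. S (x + y) = S x + S y" "\<And>c x. S (c *\<^sub>C x) = c *\<^sub>C S x"
    "\<And>x. S (cstar_adj x) = cstar_adj (S x)" "\<And>x. x \<in> pos_def_cone \<Longrightarrow> S x = \<xi>' x"
    "\<And>x. cstar_positive x \<Longrightarrow> cstar_positive (S x)" "S 1 = 1"
  proof -
    show ?thesis by (rule cone_gauge_iso_extends[of \<xi>', OF \<xi>']; (assumption | (rule that; assumption)))
  qed
  have "S (T x) = x" for x
    by (rule cone_spans[where T = "\<lambda>x. S (T x)" and S = "\<lambda>x. x"]) (simp_all add: T S l im)
  moreover have "T (S x) = x" for x
    by (rule cone_spans[where T = "\<lambda>x. T (S x)" and S = "\<lambda>x. x"]) (simp_all add: T S r)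
  ultimately have "jordan_star_iso T"
    using T S by (intro unital_order_iso_jordan[of T S]) auto
  then show ?thesis using that T(4) by blast
qed

section \<open>Order properties of Jordan isomorphisms\<close>

lemma jordan_star_iso_inv:
  assumes "jordan_star_iso J"
  shows "jordan_star_iso (inv J)"
proof -
  have J: "bij J" "\<And>x y. J (x + y) = J x + J y" "\<And>c x. J (c *\<^sub>C x) = c *\<^sub>C J x"
    "\<And>x y. J (jordan_prod x y) = jordan_prod (J x) (J y)" "\<And>x. J (cstar_adj x) = cstar_adj (J x)"
    using assms unfolding jordan_star_iso_def by blast+
  have r: "J (inv J y) = y" for y using J(1) by (simp add: bij_is_surj surj_f_inv_f)
  have inj: "x = y" if "J x = J y" for x y using J(1) that by (simp add: bij_is_inj inj_eq)
  show ?thesis unfolding jordan_star_iso_def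
    using J(1) by (auto intro!: bij_imp_bij_inv inj simp: J(2-) r)
qed

lemma jordan_star_iso_square:
  assumes "jordan_star_iso J"
  shows "J (x * x) = J x * J x"
proof -
  have "J (jordan_prod x x) = jordan_prod (J x) (J x)" using assms unfolding jordan_star_iso_def by blast
  then show ?thesis by (simp add: jordan_prod_def flip: scaleR_2)
qed

lemma jordan_star_iso_scaleR:
  assumes "jordan_star_iso J"
  shows "J (r *\<^sub>R x) = r *\<^sub>R J x"
proof -
  have "J (complex_of_real r *\<^sub>C x) = complex_of_real r *\<^sub>C J x" using assms unfolding jordan_star_iso_def by blast
  then show ?thesis by (simp only: scaleC_of_real)
qed

lemma jordan_star_iso_add: "jordan_star_iso J \<Longrightarrow> J (x + y) = J x + J y"
  unfolding jordan_star_iso_def by blast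

lemma jordan_star_iso_diff:
  assumes "jordan_star_iso J"
  shows "J (x - y) = J x - J y"
  using jordan_star_iso_add[OF assms, of "x - y" y] by simp

lemma jordan_star_iso_of_real:
  assumes J: "jordan_star_iso J"
  shows "J (of_real r) = of_real r"
proof -
  \<comment> \<open>Applying \<open>J\<close> to the Jordan product of 1 with the preimage
    \<open>b\<close> of 1 gives \<open>J 1 = J b = 1\<close>.\<close>
  obtain b where b: "J b = 1" using J unfolding jordan_star_iso_def by (metis bij_pointE)
  have "J (jordan_prod 1 b) = jordan_prod (J 1) (J b)" using J unfolding jordan_star_iso_def by blast
  then have "J 1 = 1" using b by (simp add: jordan_prod_def flip: scaleR_2)
  then show ?thesis using jordan_star_iso_scaleR[OF J, of r 1] by (simp add: of_real_def)
qed

lemma jordan_star_iso_pos: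
  assumes J: "jordan_star_iso J" and x: "cstar_positive x"
  shows "cstar_positive (J x)"
proof (rule pos_archimedean)
  fix e :: real assume "e > 0"
  then have "of_real e + x \<in> pos_def_cone" using x by (simp add: cone_add)
  then obtain q where q: "q \<in> pos_def_cone" "q * q = of_real e + x" using cone_sqrt_exists by blast
  have "self_adjoint (J q)" using J q(1) unfolding jordan_star_iso_def by (metis cone_self_adjoint)
  then have "cstar_positive (J (q * q))" by (simp add: jordan_star_iso_square[OF J] pos_square)
  then show "cstar_positive (J x + of_real e)"
    unfolding q by (simp add: jordan_star_iso_add[OF J] jordan_star_iso_of_real[OF J] add.commute)
qed

lemma jordan_star_iso_pos_iff:
  assumes J: "jordan_star_iso J"
  shows "cstar_positive (J x) \<longleftrightarrow> cstar_positive x"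
proof -
  have "inv J (J x) = x" using J unfolding jordan_star_iso_def by (simp add: bij_is_inj)
  then show ?thesis using jordan_star_iso_pos[OF J] jordan_star_iso_pos[OF jordan_star_iso_inv[OF J]] by metis
qed

text \<open>Membership in the cone amounts to a positive scalar lower bound, which a unital
  order-preserving linear map keeps.\<close>

lemma jordan_star_iso_cone:
  assumes J: "jordan_star_iso J" and x: "x \<in> pos_def_cone"
  shows "J x \<in> pos_def_cone"
proof -
  obtain r :: real where r: "0 < r" "of_real r \<sqsubseteq> x" using cone_bounded_below x by blast
  then have "of_real r \<sqsubseteq> J x"
    using jordan_star_iso_pos[OF J r(2)] by (simp add: jordan_star_iso_diff[OF J] jordan_star_iso_of_real[OF J])
  then show ?thesis using r cone_ge by blast
qed

lemma jordan_star_iso_cone_onto: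
  assumes J: "jordan_star_iso J"
  shows "J ` pos_def_cone = pos_def_cone"
proof
  show "pos_def_cone \<subseteq> J ` pos_def_cone"
  proof
    fix y :: 'b assume "y \<in> pos_def_cone"
    then have "inv J y \<in> pos_def_cone" using jordan_star_iso_cone[OF jordan_star_iso_inv[OF J]] by blast
    moreover have "J (inv J y) = y" using J unfolding jordan_star_iso_def by (simp add: bij_is_surj surj_f_inv_f)
    ultimately show "y \<in> J ` pos_def_cone" by (metis imageI)
  qed
qed (use jordan_star_iso_cone[OF J] in blast)

section \<open>Maps preserving the norm of quotients\<close>

lemma norm_le_iff_imp_eq:
  fixes u v :: real
  assumes "0 \<le> u" "0 \<le> v" "\<And>c. c \<ge> 0 \<Longrightarrow> u \<le> c \<longleftrightarrow> v \<le> c"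
  shows "u = v"
  using assms(3)[of u] assms(3)[of v] assms(1,2) by simp

lemma quotient_norm_preserving_imp_jordan:
  fixes \<phi> :: "'a::cstar_algebra \<Rightarrow> 'b::cstar_algebra"
  assumes onto: "\<phi> ` pos_def_cone = pos_def_cone"
    and norm: "\<And>x y. \<lbrakk>x \<in> pos_def_cone; y \<in> pos_def_cone\<rbrakk> \<Longrightarrow> norm (\<phi> x * alg_inv (\<phi> y)) = norm (x * alg_inv y)"
  obtains J where "jordan_star_iso J"
    "\<And>x. x \<in> pos_def_cone \<Longrightarrow> \<phi> x * \<phi> x = \<phi> 1 * (J x * J x) * \<phi> 1"
proof -
  have im: "\<phi> x \<in> pos_def_cone" if "x \<in> pos_def_cone" for x using onto that by blast
  let ?s = "\<phi> 1" and ?i = "alg_inv (\<phi> 1)"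
  have s: "?s \<in> pos_def_cone" using im by simp
  have i: "self_adjoint ?i" "alg_invertible ?i" using s by (simp_all add: alg_inv_self_adjoint)
  \<comment> \<open>Conjugating \<open>\<psi>\<close> by the inverse of \<open>\<phi> 1\<close>
    leaves the gauge relations intact and sends 1 to 1. Applied to \<open>x * x\<close>, the root
    disappears, so \<open>J x * J x = J (x * x)\<close> gives the formula for
    \<open>\<phi> x\<close>.\<close>
  define \<xi> where "\<xi> x = ?i * (\<phi> (pos_sqrt x) * \<phi> (pos_sqrt x)) * ?i" for x
  have \<xi>sq: "\<xi> (x * x) = ?i * (\<phi> x * \<phi> x) * ?i" if "x \<in> pos_def_cone" for x
    using that by (simp add: \<xi>_def pos_sqrt_eq)
  have \<xi>im: "\<xi> x \<in> pos_def_cone" if "x \<in> pos_def_cone" for x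
    unfolding \<xi>_def using i that by (intro cone_conj cone_square im pos_sqrt_cone)
  have "\<xi> ` pos_def_cone = pos_def_cone"
  proof
    show "pos_def_cone \<subseteq> \<xi> ` pos_def_cone"
    proof
      fix y :: 'b assume y: "y \<in> pos_def_cone"
      have "?s * y * ?s \<in> pos_def_cone" using s y by (simp add: cone_conj)
      then obtain q where q: "q \<in> pos_def_cone" "q * q = ?s * y * ?s" using cone_sqrt_exists by blast
      obtain z where z: "z \<in> pos_def_cone" "\<phi> z = q" using q onto by (metis imageE)
      have "\<xi> (z * z) = y" using z q s by (simp add: \<xi>sq mult.assoc)
      then show "y \<in> \<xi> ` pos_def_cone" using z cone_square by blast
    qed
  qed (use \<xi>im in blast)
  moreover have "x \<sqsubseteq> r *\<^sub>R y \<longleftrightarrow> \<xi> x \<sqsubseteq> r *\<^sub>R \<xi> y"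
    if xy: "x \<in> pos_def_cone" "y \<in> pos_def_cone" and r: "0 < r" for x y r
  proof -
    obtain u v where u: "u \<in> pos_def_cone" "u * u = x" and v: "v \<in> pos_def_cone" "v * v = y"
      using cone_sqrt_exists xy by metis
    have "x \<sqsubseteq> r *\<^sub>R y \<longleftrightarrow> norm (u * alg_inv v) \<le> sqrt r"
      using gauge_norm_iff[OF u(1) v(1), of "sqrt r"] r u v by simp
    also have "\<dots> \<longleftrightarrow> norm (\<phi> u * alg_inv (\<phi> v)) \<le> sqrt r" using norm u v by simp
    also have "\<dots> \<longleftrightarrow> \<phi> u * \<phi> u \<sqsubseteq> r *\<^sub>R (\<phi> v * \<phi> v)"
      using gauge_norm_iff[OF im[OF u(1)] im[OF v(1)], of "sqrt r"] r by simp
    also have "\<dots> \<longleftrightarrow> cstar_positive (?i * (r *\<^sub>R (\<phi> v * \<phi> v) - \<phi> u * \<phi> u) * ?i)" by (rule pos_conj_iff[OF i, symmetric])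
    also have "?i * (r *\<^sub>R (\<phi> v * \<phi> v) - \<phi> u * \<phi> u) * ?i = r *\<^sub>R \<xi> y - \<xi> x"
      using u v \<xi>sq[OF u(1)] \<xi>sq[OF v(1)] by (simp add: left_diff_distrib right_diff_distrib)
    finally show ?thesis .
  qed
  moreover have "\<xi> 1 = 1" using \<xi>sq[of 1] s by (simp add: mult.assoc)
  ultimately obtain J where J: "jordan_star_iso J" "\<And>x. x \<in> pos_def_cone \<Longrightarrow> J x = \<xi> x"
    using cone_gauge_iso_extends_to_jordan[of \<xi>] by blast
  have "\<phi> x * \<phi> x = ?s * (J x * J x) * ?s" if x: "x \<in> pos_def_cone" for x
  proof -
    have "J x * J x = ?i * (\<phi> x * \<phi> x) * ?i"
      using J(2)[OF cone_square[OF x]] \<xi>sq[OF x] jordan_star_iso_square[OF J(1)] by metis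
    then show ?thesis using s by (simp add: mult.assoc)
  qed
  then show ?thesis using that J by blast
qed

text \<open>Both \<open>J\<close> and conjugation by \<open>s\<close> preserve and reflect
  positivity, hence all gauge relations between squares.\<close>

lemma jordan_imp_quotient_norm_preserving:
  assumes J: "jordan_star_iso J" and s: "s \<in> pos_def_cone"
    and x: "x \<in> pos_def_cone" "y \<in> pos_def_cone" and p: "p \<in> pos_def_cone" "q \<in> pos_def_cone"
    and px: "p * p = s * (J x * J x) * s" and qy: "q * q = s * (J y * J y) * s"
  shows "norm (p * alg_inv q) = norm (x * alg_inv y)"
proof (rule norm_le_iff_imp_eq)
  fix c :: real assume c: "c \<ge> 0"
  have "norm (p * alg_inv q) \<le> c \<longleftrightarrow> p * p \<sqsubseteq> c\<^sup>2 *\<^sub>R (q * q)" using p c by (rule gauge_norm_iff)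
  also have "c\<^sup>2 *\<^sub>R (q * q) - p * p = s * J (c\<^sup>2 *\<^sub>R (y * y) - x * x) * s"
    by (simp add: px qy jordan_star_iso_diff[OF J] jordan_star_iso_scaleR[OF J] jordan_star_iso_square[OF J] algebra_simps)
  also have "cstar_positive \<dots> \<longleftrightarrow> x * x \<sqsubseteq> c\<^sup>2 *\<^sub>R (y * y)"
    using s by (simp add: pos_conj_iff jordan_star_iso_pos_iff[OF J])
  also have "\<dots> \<longleftrightarrow> norm (x * alg_inv y) \<le> c" using gauge_norm_iff[OF x c] by simp
  finally show "norm (p * alg_inv q) \<le> c \<longleftrightarrow> norm (x * alg_inv y) \<le> c" .
qed simp_all

text \<open>With \<open>X = l s\<^sup>-\<^sup>1\<close> the hypotheses say that \<open>k\<close> is both the real part and the absolute value of \<open>X\<close>.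
  If \<open>u\<close> is the unitary factor of \<open>X\<close> and \<open>r = k\<^sup>1\<^sup>/\<^sup>2\<close>, then \<open>r\<^sup>-\<^sup>1 u r\<close> has real part \<open>1\<close> while its spectrum
  lies in the unit disc, so it is \<open>1\<close>.\<close>

lemma real_part_eq_abs_rigid:
  fixes l k s :: "'a::cstar_algebra"
  assumes s: "s \<in> pos_def_cone" and k: "k \<in> pos_def_cone" and l: "self_adjoint l"
    and re: "l * s + s * l = 2 *\<^sub>R (s * k * s)" and abs: "l * l = s * (k * k) * s"
  shows "s * k = k * s"
proof -
  let ?i = "alg_inv s" and ?k = "alg_inv k"
  define X where "X = l * ?i"
  have i: "self_adjoint ?i" and ki: "self_adjoint ?k" using s k by (simp_all add: alg_inv_self_adjoint)
  have X': "cstar_adj X = ?i * l" using i l by (simp add: X_def cstar_adj_mult)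
  have "?i * (l * s + s * l) * ?i = ?i * l + l * ?i" using s by (simp add: distrib_left distrib_right mult.assoc)
  then have "?i * l + l * ?i = 2 *\<^sub>R k" unfolding re using s by (simp add: mult.assoc)
  then have re': "X + cstar_adj X = 2 *\<^sub>R k" unfolding X' by (simp add: X_def add.commute)
  have "cstar_adj X * X = ?i * (l * l) * ?i" unfolding X' by (simp add: X_def mult.assoc)
  then have abs': "cstar_adj X * X = k * k" unfolding abs using s by (simp add: mult.assoc)
  define U where "U = X * ?k"
  have "cstar_adj U * U = ?k * (cstar_adj X * X) * ?k" using ki by (simp add: U_def cstar_adj_mult mult.assoc)
  then have "cstar_adj U * U = 1" unfolding abs' using k by (simp add: mult.assoc)
  then have "(norm U)\<^sup>2 = 1" using cstar_identity[of U] by simp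
  then have nU: "norm U = 1" by (simp add: power2_eq_1_iff) (smt (verit) norm_ge_zero)
  obtain r where r: "r \<in> pos_def_cone" "r * r = k" using cone_sqrt_exists k by blast
  let ?r = "alg_inv r"
  have ri: "self_adjoint ?r" using r by (simp add: alg_inv_self_adjoint)
  \<comment> \<open>Since \<open>X\<close> has real part \<open>k = r * r\<close>, the element
    \<open>?r * X * ?r\<close> has real part 1, and \<open>z\<close> is its imaginary part. It
    remains to show \<open>z = 0\<close>.\<close>
  define z where "z = (- \<i>) *\<^sub>C (?r * X * ?r - 1)"
  have "?r * (X + cstar_adj X) * ?r = 2 *\<^sub>R (?r * (r * r) * ?r)" unfolding re' using r by simp
  also have "\<dots> = 2 *\<^sub>R 1" using r(1) by (simp add: mult.assoc)
  finally have W: "?r * X * ?r + ?r * cstar_adj X * ?r = 2 *\<^sub>R 1" by (simp add: distrib_left distrib_right)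
  have "cstar_adj z = \<i> *\<^sub>C (?r * cstar_adj X * ?r - 1)"
    using ri by (simp add: z_def cstar_adj_scaleC cstar_adj_mult mult.assoc)
  also have "?r * cstar_adj X * ?r - 1 = - (?r * X * ?r - 1)"
    using W by (simp add: algebra_simps scaleR_2)
  finally have saz: "self_adjoint z" by (simp only: z_def scaleC_minus_left scaleC_minus_right)
  have iz: "?r * X * ?r - 1 = \<i> *\<^sub>C z" by (simp add: z_def scaleC_scaleC)
  have rXr: "?r * X * ?r = ?r * U * r"
  proof -
    have "U * (r * r) = X" using r k by (simp add: U_def)
    then have "?r * X * ?r = ?r * (U * (r * r)) * ?r" by simp
    also have "\<dots> = ?r * U * r" using r(1) by (simp add: mult.assoc)
    finally show ?thesis .
  qed
  have "z = 0"
  proof (rule ccontr)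
    assume nz: "z \<noteq> 0"
    \<comment> \<open>For real \<open>c\<close> other than 0, the number \<open>1 + ic\<close> has
      modulus above \<open>norm U = 1\<close>, so it is outside the spectrum of \<open>U\<close> and
      of its similar copy \<open>?r * U * r = 1 + iz\<close>. Thus \<open>z\<close> has no nonzero
      real spectral value.\<close>
    have inv: "alg_invertible (z - complex_of_real c *\<^sub>C 1)" if c: "c \<noteq> 0" for c
    proof -
      let ?w = "1 + \<i> * complex_of_real c"
      have "(cmod ?w)\<^sup>2 = 1 + c\<^sup>2" by (simp add: cmod_power2)
      then have "1\<^sup>2 < (cmod ?w)\<^sup>2" using c by simp
      then have "norm U < cmod ?w" using nU by (metis norm_ge_zero power_less_imp_less_base)
      then have "alg_invertible (U - ?w *\<^sub>C 1)" by (rule alg_invertible_scaleC_minus)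
      then have "alg_invertible (?r * (U - ?w *\<^sub>C 1) * r)" using r(1) by (simp add: alg_invertible_mult)
      also have "?r * (U - ?w *\<^sub>C 1) * r = ?r * X * ?r - ?w *\<^sub>C 1"
        using r(1) by (simp add: rXr right_diff_distrib left_diff_distrib mult_scaleC_left mult_scaleC_right)
      also have "\<dots> = \<i> *\<^sub>C z - (\<i> * complex_of_real c) *\<^sub>C 1" by (simp add: scaleC_add_left flip: iz)
      also have "\<dots> = (\<i> *\<^sub>C 1) * (z - complex_of_real c *\<^sub>C 1)"
        by (simp only: mult_scaleC_left mult_1_left scaleC_diff_right scaleC_scaleC)
      finally have "alg_invertible ((\<i> *\<^sub>C 1) * (z - complex_of_real c *\<^sub>C 1))" .
      moreover have "alg_invertible (\<i> *\<^sub>C (1::'a))"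
        by (rule alg_invI[of _ "(- \<i>) *\<^sub>C 1"]) (simp_all add: mult_scaleC_left scaleC_scaleC)
      ultimately show ?thesis using alg_invertible_mult_iff(1) by blast
    qed
    show False using self_adjoint_norm_in_spectrum[OF saz] inv[of "norm z"] inv[of "- norm z"] nz
      unfolding scaleC_of_real_one by simp
  qed
  then have "?r * X * ?r = 1" using iz by simp
  then have "r * (?r * X * ?r) * r = r * r" by simp
  then have "X = k" using r by (simp add: mult.assoc)
  then have lk: "l = k * s" using s by (simp add: X_def flip: \<open>X = k\<close>)
  then have "cstar_adj l = s * k" using s k by (simp add: cstar_adj_mult)
  then show ?thesis using l lk by simp
qed

lemma central_if_commutes_with_cone:
  assumes "\<And>x. x \<in> pos_def_cone \<Longrightarrow> s * x = x * s"
  shows "central (s :: 'a::cstar_algebra)"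
  unfolding central_def
proof
  fix a
  show "s * a = a * s"
    by (rule cone_spans[where T = "\<lambda>a. s * a" and S = "\<lambda>a. a * s"])
      (simp_all add: assms distrib_left distrib_right mult_scaleC_left mult_scaleC_right)
qed

theorem theorem2p3:
  fixes \<phi> :: "'a::cstar_algebra \<Rightarrow> 'b::cstar_algebra"
  assumes "\<phi> ` pos_def_cone = pos_def_cone"
  shows
    "((\<forall>x\<in>pos_def_cone. \<forall>y\<in>pos_def_cone. norm (\<phi> x * alg_inv (\<phi> y)) = norm (x * alg_inv y))
      \<longleftrightarrow>
      (\<exists>J. jordan_star_iso J \<and>
        (\<forall>x\<in>pos_def_cone. \<phi> x = pos_sqrt (\<phi> 1 * (J x)\<^sup>2 * \<phi> 1))))
     \<and>
     ((\<forall>x\<in>pos_def_cone. \<forall>y\<in>pos_def_cone. norm (\<phi> x * alg_inv (\<phi> y)) = norm (x * alg_inv y))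
      \<longrightarrow>
      ((\<forall>x\<in>pos_def_cone. \<forall>y\<in>pos_def_cone. \<phi> (x + y) = \<phi> x + \<phi> y) \<longleftrightarrow> central (\<phi> 1)) \<and>
      (central (\<phi> 1) \<longrightarrow>
        (\<forall>J. jordan_star_iso J \<and>
             (\<forall>x\<in>pos_def_cone. \<phi> x = pos_sqrt (\<phi> 1 * (J x)\<^sup>2 * \<phi> 1)) \<longrightarrow>
             (\<forall>x\<in>pos_def_cone. \<phi> x = \<phi> 1 * J x))))"
    (is "(?i \<longleftrightarrow> (\<exists>J. ?ii J)) \<and> (?i \<longrightarrow> (?add \<longleftrightarrow> ?cen) \<and> (?cen \<longrightarrow> (\<forall>J. ?ii J \<longrightarrow> ?prod J)))")
proof -
  have im: "\<phi> x \<in> pos_def_cone" if "x \<in> pos_def_cone" for x using assms that by blast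
  then have s: "\<phi> 1 \<in> pos_def_cone" by simp
  \<comment> \<open>\<open>pos_sqrt\<close> is a definite description, so its argument has to be
    placed in the cone before it can be squared.\<close>
  have sq: "\<phi> x * \<phi> x = \<phi> 1 * (J x * J x) * \<phi> 1" if J: "?ii J" and x: "x \<in> pos_def_cone" for J x
  proof -
    have "\<phi> 1 * (J x)\<^sup>2 * \<phi> 1 \<in> pos_def_cone"
      unfolding power2_eq_square
      using s jordan_star_iso_cone[OF conjunct1[OF J] x] by (simp add: cone_conj cone_square)
    from pos_sqrt_cone(2)[OF this] show ?thesis
      using conjunct2[OF J, rule_format, OF x] by (simp only: power2_eq_square)
  qed
  have i_ii: "\<exists>J. ?ii J" if ?i
  proof -
    have n: "norm (\<phi> x * alg_inv (\<phi> y)) = norm (x * alg_inv y)"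
      if "x \<in> pos_def_cone" "y \<in> pos_def_cone" for x y using \<open>?i\<close> that by blast
    obtain J where J: "jordan_star_iso J" "\<And>x. x \<in> pos_def_cone \<Longrightarrow> \<phi> x * \<phi> x = \<phi> 1 * (J x * J x) * \<phi> 1"
    proof -
      show ?thesis by (rule quotient_norm_preserving_imp_jordan[OF assms n]; (assumption | (rule that; assumption)))
    qed
    have "\<phi> x = pos_sqrt (\<phi> 1 * (J x)\<^sup>2 * \<phi> 1)" if "x \<in> pos_def_cone" for x
      unfolding power2_eq_square J(2)[OF that, symmetric] using im that by (simp add: pos_sqrt_eq)
    with J show ?thesis by blast
  qed
  have ii_i: ?i if J: "?ii J" for J
  proof (intro ballI)
    fix x y :: 'a assume xy: "x \<in> pos_def_cone" "y \<in> pos_def_cone"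
    show "norm (\<phi> x * alg_inv (\<phi> y)) = norm (x * alg_inv y)"
      using jordan_imp_quotient_norm_preserving[OF conjunct1[OF J] s xy im[OF xy(1)] im[OF xy(2)]
          sq[OF J xy(1)] sq[OF J xy(2)]] .
  qed
  \<comment> \<open>For central \<open>\<phi> 1\<close> the product \<open>\<phi> 1 * J x\<close> is
    a positive root of the same element as \<open>\<phi> x\<close>.\<close>
  have prod: "?prod J" if "?cen" and J: "?ii J" for J
  proof
    fix x :: 'a assume x: "x \<in> pos_def_cone"
    have c: "\<phi> 1 * a = a * \<phi> 1" for a using \<open>?cen\<close> unfolding central_def by blast
    have Jx: "J x \<in> pos_def_cone" using J x jordan_star_iso_cone by blast
    have "\<phi> 1 * J x \<in> pos_def_cone"
      using s Jx by (intro coneI pos_mult_commuting alg_invertible_mult c) (simp_all add: cone_pos)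
    moreover have "\<phi> x * \<phi> x = (\<phi> 1 * J x) * (\<phi> 1 * J x)"
    proof -
      have "\<phi> 1 * (J x * J x) * \<phi> 1 = \<phi> 1 * J x * (J x * \<phi> 1)" by (simp only: mult.assoc)
      then show ?thesis using sq[OF J x] c[of "J x"] by metis
    qed
    ultimately show "\<phi> x = \<phi> 1 * J x" using cone_sqrt_unique cone_pos[OF im[OF x]] by blast
  qed
  \<comment> \<open>As \<open>J\<close> maps the cone onto the cone, commuting with every
    \<open>J x\<close> is enough; subtracting the squares at \<open>x\<close> and 1 from that at
    \<open>x + 1\<close> isolates the mixed terms.\<close>
  have add_cen: "?cen" if "?add" and J: "?ii J" for J
  proof (rule central_if_commutes_with_cone)
    fix y :: 'b assume "y \<in> pos_def_cone"
    then obtain x where x: "x \<in> pos_def_cone" "y = J x" using J jordan_star_iso_cone_onto by blast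
    have y: "y \<in> pos_def_cone" by fact
    let ?s = "\<phi> 1"
    have jJ: "jordan_star_iso J" using J by blast
    have "J 1 = 1" using jordan_star_iso_of_real[OF jJ, of 1] by simp
    then have "J (x + 1) = y + 1" using x jordan_star_iso_add[OF jJ, of x 1] by simp
    moreover have "\<phi> (x + 1) = \<phi> x + ?s" using \<open>?add\<close> x by simp
    moreover have "x + 1 \<in> pos_def_cone" using x by (simp add: cone_add)
    ultimately have "(\<phi> x + ?s) * (\<phi> x + ?s) = ?s * ((y + 1) * (y + 1)) * ?s" using sq[OF J, of "x + 1"] by simp
    moreover have xx: "\<phi> x * \<phi> x = ?s * (y * y) * ?s" using sq[OF J x(1)] x by simp
    ultimately have "\<phi> x * ?s + ?s * \<phi> x = 2 *\<^sub>R (?s * y * ?s)"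
      by (simp add: algebra_simps scaleR_2)
    then show "?s * y = y * ?s" using s y im[OF x(1)] xx by (intro real_part_eq_abs_rigid[of ?s y "\<phi> x"]) simp_all
  qed
  have cen_add: "?add" if "?cen" and J: "?ii J" for J
  proof (intro ballI)
    fix x y :: 'a assume xy: "x \<in> pos_def_cone" "y \<in> pos_def_cone"
    note p = prod[OF that, rule_format]
    show "\<phi> (x + y) = \<phi> x + \<phi> y"
      unfolding p[OF xy(1)] p[OF xy(2)] p[OF cone_add_cone[OF xy]] jordan_star_iso_add[OF conjunct1[OF J]]
      by (rule distrib_left)
  qed
  show ?thesis using i_ii ii_i prod add_cen cen_add by blast
qed

end
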